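(* Let $\mathcal{A}$ be a finite von Neumann algebra and let $\Phi:\mathcal{A}\to\mathcal{A}$ be a linear map. Then $\Phi$ preserves the extreme points of the unit ball of $\mathcal{A}$ if and only if there exist a unitary operator $U\in\mathcal{A}$ and a unital Jordan $*$-homomorphism $\Psi:\mathcal{A}\to\mathcal{A}$ such that $$\Phi(A)=U\Psi(A)\qquad (A\in\mathcal{A}).$$
   Context: All Hilbert spaces and algebras are complex, and linear means complex-linear. A von Neumann algebra $\mathcal{A}$ with identity $I$ is finite if $V\in\mathcal{A}$, $V^*V=I$ implies $VV^*=I$. The unit ball of $\mathcal{A}$ is $\{A\in\mathcal{A}:\|A\|\le 1\}$, where $\|\cdot\|$ is the operator norm. A linear map $\Phi:\mathcal{A}\to\mathcal{A}$ preserves the extreme points of the unit ball if $\Phi(A)$ is an extreme point of the unit ball of $\mathcal{A}$ whenever $A$ is one. No continuity of $\Phi$ is assumed. A Jordan $*$-homomorphism between $*$-algebras is a linear map $J$ satisfying $J(x)^2=J(x^2)$ and $J(x)^*=J(x^* )$ for every $x$; it is unital if it maps the identity to the identity. *)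

theory Defs
  imports "HOL-Analysis.Analysis"
begin

section \<open>Complex Hilbert spaces\<close>

class scaleC = scaleR +
  fixes scaleC :: "complex \<Rightarrow> 'a \<Rightarrow> 'a"  (infixr \<open>*\<^sub>C\<close> 75)

class complex_vector = scaleC + real_vector +
  assumes scaleC_add_right: "c *\<^sub>C (x + y) = c *\<^sub>C x + c *\<^sub>C y"
    and scaleC_add_left: "(c + d) *\<^sub>C x = c *\<^sub>C x + d *\<^sub>C x"
    and scaleC_scaleC: "c *\<^sub>C (d *\<^sub>C x) = (c * d) *\<^sub>C x"
    and scaleR_scaleC: "r *\<^sub>R x = complex_of_real r *\<^sub>C x"

text \<open>The complex inner product is linear in its first argument. Its real part is the inner
  product of the underlying real space, so positive definiteness, and the fact that the norm is
  the one induced by the complex inner product, come from class \<^class>\<open>real_inner\<close>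
  (see \<open>cinner_self\<close> below).\<close>

class complex_inner = complex_vector + real_inner +
  fixes cinner :: "'a \<Rightarrow> 'a \<Rightarrow> complex"
  assumes cinner_commute: "cinner x y = cnj (cinner y x)"
    and cinner_add_left: "cinner (x + y) z = cinner x z + cinner y z"
    and cinner_scaleC_left: "cinner (c *\<^sub>C x) y = c * cinner x y"
    and inner_eq_Re_cinner: "inner x y = Re (cinner x y)"

class chilbert_space = complex_inner + complete_space

lemma cinner_self: "cinner x x = complex_of_real ((norm x)\<^sup>2)"
  for x :: "'a :: complex_inner"
proof (rule complex_eqI)
  show "Re (cinner x x) = Re (complex_of_real ((norm x)\<^sup>2))"
    by (simp add: inner_eq_Re_cinner [symmetric] power2_norm_eq_inner del: of_real_power)
  have "cinner x x = cnj (cinner x x)"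
    by (rule cinner_commute)
  then have "Im (cinner x x) = - Im (cinner x x)"
    by (metis cnj.simps(2))
  then show "Im (cinner x x) = Im (complex_of_real ((norm x)\<^sup>2))"
    by (simp del: of_real_power)
qed

lemma norm_scaleC: "norm (c *\<^sub>C x) = cmod c * norm x"
  for x :: "'a :: complex_inner"
proof -
  have "cinner (c *\<^sub>C x) (c *\<^sub>C x) = c * cnj c * cinner x x"
    by (metis cinner_commute cinner_scaleC_left complex_cnj_mult mult.assoc mult.commute)
  then have "complex_of_real ((norm (c *\<^sub>C x))\<^sup>2) = complex_of_real ((cmod c * norm x)\<^sup>2)"
    by (simp add: cinner_self complex_norm_square [symmetric] power_mult_distrib)
  then have "(norm (c *\<^sub>C x))\<^sup>2 = (cmod c * norm x)\<^sup>2"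
    using of_real_eq_iff by blast
  then show ?thesis
    by (simp add: power2_eq_iff_nonneg)
qed

lemma bounded_linear_scaleC: "bounded_linear (\<lambda>x :: 'a :: complex_inner. c *\<^sub>C x)"
proof (rule bounded_linear_intro [where K = "cmod c"])
  fix x y :: 'a and r :: real
  show "c *\<^sub>C (x + y) = c *\<^sub>C x + c *\<^sub>C y"
    by (rule scaleC_add_right)
  show "c *\<^sub>C (r *\<^sub>R x) = r *\<^sub>R (c *\<^sub>C x)"
    by (simp add: scaleR_scaleC scaleC_scaleC mult.commute)
  show "norm (c *\<^sub>C x) \<le> norm x * cmod c"
    by (simp add: norm_scaleC mult.commute)
qed


section \<open>Bounded operators\<close>

instantiation blinfun :: (real_normed_vector, complex_inner) complex_vector
begin

lift_definition scaleC_blinfun ::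
  "complex \<Rightarrow> ('a \<Rightarrow>\<^sub>L 'b) \<Rightarrow> ('a \<Rightarrow>\<^sub>L 'b)" is "\<lambda>c f x. c *\<^sub>C f x"
  by (rule bounded_linear_compose [OF bounded_linear_scaleC])

instance
  by standard
    (transfer, simp add: scaleC_add_right scaleC_add_left scaleC_scaleC scaleR_scaleC fun_eq_iff)+

end

text \<open>The elements of \<^typ>\<open>'a \<Rightarrow>\<^sub>L 'a\<close> are only real-linear; \<open>bounded_operators\<close>
  is the algebra of bounded complex-linear operators. Its operator norm is the norm of
  \<^typ>\<open>'a \<Rightarrow>\<^sub>L 'a\<close>.\<close>

definition bounded_operators :: "('a :: chilbert_space \<Rightarrow>\<^sub>L 'a) set" where
  "bounded_operators =
     {A. \<forall>c x. blinfun_apply A (c *\<^sub>C x) = c *\<^sub>C blinfun_apply A x}"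

definition adj :: "('a :: chilbert_space \<Rightarrow>\<^sub>L 'a) \<Rightarrow> ('a \<Rightarrow>\<^sub>L 'a)" where
  "adj A = (THE B. \<forall>x y. cinner (blinfun_apply A x) y = cinner x (blinfun_apply B y))"

definition unitary_op :: "('a :: chilbert_space \<Rightarrow>\<^sub>L 'a) \<Rightarrow> bool" where
  "unitary_op U \<longleftrightarrow>
     U \<in> bounded_operators \<and> adj U o\<^sub>L U = id_blinfun \<and> U o\<^sub>L adj U = id_blinfun"


section \<open>Von Neumann algebras\<close>

definition commutant ::
  "('a :: chilbert_space \<Rightarrow>\<^sub>L 'a) set \<Rightarrow> ('a \<Rightarrow>\<^sub>L 'a) set" where
  "commutant S = {T \<in> bounded_operators. \<forall>A\<in>S. T o\<^sub>L A = A o\<^sub>L T}"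

definition unital_star_subalgebra :: "('a :: chilbert_space \<Rightarrow>\<^sub>L 'a) set \<Rightarrow> bool" where
  "unital_star_subalgebra M \<longleftrightarrow>
     M \<subseteq> bounded_operators \<and>
     id_blinfun \<in> M \<and>
     (\<forall>A\<in>M. \<forall>B\<in>M. A + B \<in> M) \<and>
     (\<forall>c. \<forall>A\<in>M. c *\<^sub>C A \<in> M) \<and>
     (\<forall>A\<in>M. \<forall>B\<in>M. A o\<^sub>L B \<in> M) \<and>
     (\<forall>A\<in>M. adj A \<in> M)"

definition von_neumann_algebra :: "('a :: chilbert_space \<Rightarrow>\<^sub>L 'a) set \<Rightarrow> bool" where
  "von_neumann_algebra M \<longleftrightarrow> unital_star_subalgebra M \<and> commutant (commutant M) = M"

definition finite_von_neumann_algebra ::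
  "('a :: chilbert_space \<Rightarrow>\<^sub>L 'a) set \<Rightarrow> bool" where
  "finite_von_neumann_algebra M \<longleftrightarrow>
     von_neumann_algebra M \<and>
     (\<forall>V\<in>M. adj V o\<^sub>L V = id_blinfun \<longrightarrow> V o\<^sub>L adj V = id_blinfun)"

definition unit_ball :: "('a :: chilbert_space \<Rightarrow>\<^sub>L 'a) set \<Rightarrow> ('a \<Rightarrow>\<^sub>L 'a) set" where
  "unit_ball M = {A \<in> M. norm A \<le> 1}"


section \<open>Maps on an algebra\<close>

text \<open>A map from \<open>M\<close> to \<open>M\<close> is a function on all of \<^typ>\<open>'a \<Rightarrow>\<^sub>L 'a\<close> of which
  only the values on \<open>M\<close> matter.\<close>

definition clinear_map_on ::
  "('a :: chilbert_space \<Rightarrow>\<^sub>L 'a) set \<Rightarrow> (('a \<Rightarrow>\<^sub>L 'a) \<Rightarrow> ('a \<Rightarrow>\<^sub>L 'a)) \<Rightarrow> bool" where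
  "clinear_map_on M F \<longleftrightarrow>
     F \<in> M \<rightarrow> M \<and>
     (\<forall>A\<in>M. \<forall>B\<in>M. F (A + B) = F A + F B) \<and>
     (\<forall>c. \<forall>A\<in>M. F (c *\<^sub>C A) = c *\<^sub>C F A)"

definition preserves_extreme_points ::
  "('a :: chilbert_space \<Rightarrow>\<^sub>L 'a) set \<Rightarrow> (('a \<Rightarrow>\<^sub>L 'a) \<Rightarrow> ('a \<Rightarrow>\<^sub>L 'a)) \<Rightarrow> bool" where
  "preserves_extreme_points M F \<longleftrightarrow>
     (\<forall>A. A extreme_point_of unit_ball M \<longrightarrow> F A extreme_point_of unit_ball M)"

definition jordan_star_hom ::
  "('a :: chilbert_space \<Rightarrow>\<^sub>L 'a) set \<Rightarrow> (('a \<Rightarrow>\<^sub>L 'a) \<Rightarrow> ('a \<Rightarrow>\<^sub>L 'a)) \<Rightarrow> bool" where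
  "jordan_star_hom M J \<longleftrightarrow>
     clinear_map_on M J \<and>
     (\<forall>A\<in>M. J A o\<^sub>L J A = J (A o\<^sub>L A)) \<and>
     (\<forall>A\<in>M. adj (J A) = J (adj A))"

definition unital_jordan_star_hom ::
  "('a :: chilbert_space \<Rightarrow>\<^sub>L 'a) set \<Rightarrow> (('a \<Rightarrow>\<^sub>L 'a) \<Rightarrow> ('a \<Rightarrow>\<^sub>L 'a)) \<Rightarrow> bool" where
  "unital_jordan_star_hom M J \<longleftrightarrow> jordan_star_hom M J \<and> J id_blinfun = id_blinfun"

end

theory Submission
  imports Defs
begin

text \<open>In a finite von Neumann algebra the extreme points of the unit ball are the unitaries. An extreme
  point \<open>V\<close> is a partial isometry, since otherwise it is a proper mean of contractions \<open>V f(V\<^sup>* V)\<close>, and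
  it satisfies \<open>(1 - V V\<^sup>*) M (1 - V\<^sup>* V) = 0\<close>. A central projection separates the two defect
  projections, so \<open>V\<close> splits into an isometry and a coisometry, and finiteness makes it unitary.

  If \<open>\<Phi>\<close> preserves unitaries, then so does \<open>\<Psi> = \<Phi>(1)\<^sup>* \<Phi>\<close>. A self-adjoint \<open>A\<close> of norm at most \<open>1/2\<close> is a
  combination of the unitaries \<open>sqrt (1 - A\<^sup>2) \<plusminus> \<i> A\<close>, so \<open>\<Psi>\<close> is bounded on self-adjoint elements.
  Replacing \<open>A\<close> by \<open>t A\<close> and comparing powers of \<open>t\<close> in the unitarity relations of the images gives
  \<open>\<Psi>(A)\<^sup>* = \<Psi>(A)\<close> and \<open>\<Psi>(A)\<^sup>2 = \<Psi>(A\<^sup>2)\<close>.\<close>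


section \<open>Orthogonal projections\<close>

text \<open>Bounded operators into a Banach space again form a Banach space; the fixed point
  argument for the square root uses this completeness.\<close>

instance chilbert_space \<subseteq> banach ..

text \<open>A minimizing sequence for the distance to \<open>S\<close> is Cauchy by the
  parallelogram law. The residual at its limit is orthogonal to \<open>S\<close>, since no
  displacement inside \<open>S\<close> can shorten it.\<close>

lemma subspace_projection_exists:
  fixes S :: "'a :: {real_inner, complete_space} set"
  assumes S: "subspace S" "closed S"
  obtains y where "y \<in> S" "\<And>s. s \<in> S \<Longrightarrow> inner (x - y) s = 0"
proof -
  define d where "d = Inf ((\<lambda>s. (norm (x - s))\<^sup>2) ` S)"
  have ne: "S \<noteq> {}" using S(1) subspace_0 by blast
  have bdd: "bdd_below ((\<lambda>s. (norm (x - s))\<^sup>2) ` S)" by (rule bdd_belowI2[of _ 0]) simp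
  have d_le: "d \<le> (norm (x - s))\<^sup>2" if "s \<in> S" for s
    unfolding d_def using bdd that by (rule cINF_lower)
  have "\<exists>s\<in>S. (norm (x - s))\<^sup>2 < d + 1 / Suc n" for n
    using cINF_less_iff[OF ne bdd, of "d + 1 / Suc n"] unfolding d_def by simp
  then obtain f where f: "\<And>n. f n \<in> S" "\<And>n. (norm (x - f n))\<^sup>2 < d + 1 / Suc n" by metis
  have close: "(dist (f m) (f n))\<^sup>2 \<le> 2 / Suc m + 2 / Suc n" for m n
  proof -
    have mid: "(1/2) *\<^sub>R (f m + f n) \<in> S"
      using S(1) f(1) by (simp add: subspace_add subspace_scale)
    \<comment> \<open>Parallelogram law for \<open>x - f m\<close> and \<open>x - f n\<close>; the
      midpoint lies in \<open>S\<close>, so its squared distance is at least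
      \<open>d\<close>.\<close>
    have "(dist (f m) (f n))\<^sup>2 + 4 * (norm (x - (1/2) *\<^sub>R (f m + f n)))\<^sup>2
        = 2 * (norm (x - f m))\<^sup>2 + 2 * (norm (x - f n))\<^sup>2"
      unfolding dist_norm power2_norm_eq_inner
      by (simp add: inner_diff inner_add algebra_simps inner_commute)
    with d_le[OF mid] f(2)[of m] f(2)[of n] show ?thesis by simp
  qed
  have "Cauchy f"
  proof (rule metric_CauchyI)
    fix e :: real assume e: "0 < e"
    obtain N where N: "4 / e\<^sup>2 < real N" using reals_Archimedean2 by blast
    have "dist (f m) (f n) < e" if "m \<ge> N" "n \<ge> N" for m n
    proof -
      have *: "2 / real (Suc k) < e\<^sup>2 / 2" if "k \<ge> N" for k
      proof -
        have "4 / e\<^sup>2 < real (Suc k)" using N that by linarith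
        then show ?thesis using e by (simp add: field_simps)
      qed
      have "(dist (f m) (f n))\<^sup>2 < e\<^sup>2"
        using close[of m n] *[OF that(1)] *[OF that(2)] by linarith
      then show ?thesis using e by (simp add: power_less_imp_less_base)
    qed
    then show "\<exists>M. \<forall>m\<ge>M. \<forall>n\<ge>M. dist (f m) (f n) < e" by blast
  qed
  then obtain y where y: "f \<longlonglongrightarrow> y" using Cauchy_convergent convergent_def by blast
  have yS: "y \<in> S" using closed_sequentially[OF S(2)] f(1) y by blast
  have "(\<lambda>n. (norm (x - f n))\<^sup>2) \<longlonglongrightarrow> (norm (x - y))\<^sup>2" by (intro tendsto_intros y)
  moreover have "(\<lambda>n. d + 1 / Suc n) \<longlonglongrightarrow> d + 0"
    by (intro tendsto_intros LIMSEQ_Suc[OF lim_1_over_n])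
  ultimately have "(norm (x - y))\<^sup>2 \<le> d + 0"
    by (rule LIMSEQ_le) (use f(2) less_imp_le in blast)
  then have yd: "(norm (x - y))\<^sup>2 \<le> d" by simp
  have "inner (x - y) s = 0" if s: "s \<in> S" for s
  proof (cases "s = 0")
    case False
    \<comment> \<open>\<open>c *\<^sub>R s\<close> is the component of the residual along
      \<open>s\<close>. Removing it lowers the squared distance by
      \<open>(inner (x - y) s)\<^sup>2 / inner s s\<close>, which minimality forces to be
      zero.\<close>
    define c where "c = inner (x - y) s / inner s s"
    have ss: "inner s s > 0" using False by simp
    have "y + c *\<^sub>R s \<in> S" using S(1) yS s by (simp add: subspace_add subspace_scale)
    from d_le[OF this] yd have "(norm (x - y))\<^sup>2 \<le> (norm (x - (y + c *\<^sub>R s)))\<^sup>2" by linarith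
    also have "x - (y + c *\<^sub>R s) = (x - y) - c *\<^sub>R s" by simp
    also have "(norm ((x - y) - c *\<^sub>R s))\<^sup>2
        = (norm (x - y))\<^sup>2 - 2 * c * inner (x - y) s + c\<^sup>2 * inner s s"
      unfolding power2_norm_eq_inner inner_diff_left inner_diff_right
      by (simp add: inner_commute power2_eq_square algebra_simps)
    also have "\<dots> = (norm (x - y))\<^sup>2 - (inner (x - y) s)\<^sup>2 / inner s s"
      using ss by (simp add: c_def power2_eq_square field_simps)
    finally have "(inner (x - y) s)\<^sup>2 \<le> 0" using ss by (simp add: field_simps)
    then show ?thesis by simp
  qed simp
  with yS that show thesis by blast
qed

text \<open>The representing vector is a multiple of a vector \<open>w\<close> normal to the kernel:
  every \<open>z\<close> differs from a multiple of \<open>w\<close> by an element of the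
  kernel.\<close>

lemma riesz_representation:
  fixes f :: "'a :: {real_inner, complete_space} \<Rightarrow> real"
  assumes f: "bounded_linear f"
  obtains y where "\<And>x. f x = inner x y"
proof (cases "\<forall>x. f x = 0")
  case True
  then show ?thesis using that[of 0] by simp
next
  case False
  then obtain x where x: "f x \<noteq> 0" by blast
  interpret f: bounded_linear f by fact
  have "closed {x. f x = 0}"
    by (intro closed_Collect_eq continuous_intros f.continuous_on)
  moreover have "subspace {x. f x = 0}"
    by (auto simp: subspace_def f.zero f.add f.scaleR)
  ultimately obtain p where "p \<in> {x. f x = 0}"
      "\<And>s. s \<in> {x. f x = 0} \<Longrightarrow> inner (x - p) s = 0"
    using subspace_projection_exists[of "{x. f x = 0}" x] by blast
  then have p: "f p = 0" "\<And>s. f s = 0 \<Longrightarrow> inner (x - p) s = 0" by auto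
  define w where "w = x - p"
  have fw: "f w \<noteq> 0" using x p(1) by (simp add: w_def f.diff)
  have ww: "inner w w \<noteq> 0" using fw f.zero by auto
  show ?thesis
  proof (rule that)
    fix z
    have "f (z - (f z / f w) *\<^sub>R w) = 0" using fw by (simp add: f.diff f.scaleR)
    then have "inner w (z - (f z / f w) *\<^sub>R w) = 0" using p(2) w_def by blast
    then have "inner z w = (f z / f w) * inner w w"
      by (simp add: inner_diff_right inner_commute)
    then show "f z = inner z ((f w / inner w w) *\<^sub>R w)"
      using fw ww by simp
  qed
qed

lemma blinfun_real_adjoint_exists:
  fixes A :: "'a :: {real_inner, complete_space} \<Rightarrow>\<^sub>L 'a"
  obtains B :: "'a \<Rightarrow>\<^sub>L 'a" where "\<And>x y. inner (A x) y = inner x (B y)"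
proof -
  have "\<exists>z. \<forall>x. inner (A x) y = inner x z" for y
  proof -
    have "bounded_linear (\<lambda>x. inner (A x) y)"
      by (intro bounded_linear_intros)
    then show ?thesis using riesz_representation by metis
  qed
  then obtain g where g: "\<And>x y. inner (A x) y = inner x (g y)" by metis
  have "bounded_linear g"
  proof (rule bounded_linear_intro)
    show "g (x + y) = g x + g y" for x y
      by (rule vector_eq_rdot[THEN iffD1]) (metis g inner_add_left inner_commute inner_add_right)
    show "g (r *\<^sub>R x) = r *\<^sub>R g x" for r x
      by (rule vector_eq_rdot[THEN iffD1]) (metis g inner_commute inner_scaleR_right)
    show "norm (g y) \<le> norm y * norm A" for y
    proof -
      have "(norm (g y))\<^sup>2 = inner (A (g y)) y" by (simp add: g power2_norm_eq_inner)
      also have "\<dots> \<le> norm (A (g y)) * norm y" by (rule norm_cauchy_schwarz)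
      also have "\<dots> \<le> norm A * norm (g y) * norm y"
        by (intro mult_right_mono norm_blinfun) simp
      finally have "norm (g y) * norm (g y) \<le> norm (g y) * (norm y * norm A)"
        by (simp add: power2_eq_square mult_ac)
      then show ?thesis
        by (cases "norm (g y) = 0") (auto simp: mult_le_cancel_left intro: mult_nonneg_nonneg)
    qed
  qed
  then show thesis using that[of "Blinfun g"] g by (simp add: bounded_linear_Blinfun_apply)
qed

section \<open>Adjoints\<close>

lemma inner_scaleC_left: "inner (c *\<^sub>C x) y = inner x (cnj c *\<^sub>C y)"
  for x y :: "'a :: complex_inner"
  unfolding inner_eq_Re_cinner
  by (metis cinner_commute cinner_scaleC_left complex_cnj_cnj complex_cnj_mult)

text \<open>The imaginary part is a real part after rotation by \<open>\<i>\<close>, so identities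
  for complex-linear operators can be checked with the real inner product alone.\<close>

lemma cinner_eq_inner: "cinner x y = Complex (inner x y) (- inner (\<i> *\<^sub>C x) y)"
  for x y :: "'a :: complex_inner"
  by (simp add: inner_eq_Re_cinner cinner_scaleC_left complex_eq_iff)

text \<open>Resolves the definite description in \<open>adj\<close>. Complex linearity of
  \<open>A\<close> upgrades the real identity to the complex one, so every computation of an adjoint
  below only has to verify the real one.\<close>

lemma adj_unique:
  fixes A B :: "'a :: chilbert_space \<Rightarrow>\<^sub>L 'a"
  assumes A: "A \<in> bounded_operators" and B: "\<And>x y. inner (A x) y = inner x (B y)"
  shows "adj A = B"
  unfolding adj_def
proof (rule the_equality)
  show "\<forall>x y. cinner (A x) y = cinner x (B y)"
    using A unfolding bounded_operators_def
    by (simp add: cinner_eq_inner flip: B)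
next
  fix C assume C: "\<forall>x y. cinner (A x) y = cinner x (blinfun_apply C y)"
  show "C = B"
    by (rule blinfun_eqI, rule vector_eq_rdot[THEN iffD1])
      (metis B C inner_eq_Re_cinner inner_commute)
qed

lemma inner_adj:
  assumes "A \<in> bounded_operators"
  shows "inner (A x) y = inner x (adj A y)"
proof -
  obtain B where B: "\<And>x y. inner (A x) y = inner x (blinfun_apply B y)"
    using blinfun_real_adjoint_exists[of A] by blast
  show ?thesis using adj_unique[OF assms B] B by simp
qed

lemma bounded_operators_scaleC:
  "A \<in> bounded_operators \<Longrightarrow> blinfun_apply A (c *\<^sub>C x) = c *\<^sub>C A x"
  by (simp add: bounded_operators_def)

lemma scaleC_zero_left [simp]: "0 *\<^sub>C x = 0" for x :: "'a :: complex_vector"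
  using scaleR_scaleC[of 0 x] by simp

lemma scaleC_one [simp]: "1 *\<^sub>C x = x" for x :: "'a :: complex_vector"
  using scaleR_scaleC[of 1 x] by simp

lemma scaleC_minus1: "(- 1) *\<^sub>C x = - x" for x :: "'a :: complex_vector"
  using scaleR_scaleC[of "-1" x] by simp

lemma scaleC_zero_right [simp]: "c *\<^sub>C 0 = (0 :: 'a :: complex_vector)"
  using scaleC_add_right[of c 0 "0 :: 'a"] by simp

lemma scaleC_minus_right: "c *\<^sub>C (- x) = - (c *\<^sub>C x)" for x :: "'a :: complex_vector"
  by (metis mult.commute scaleC_minus1 scaleC_scaleC)

lemma scaleC_diff_right: "c *\<^sub>C (x - y) = c *\<^sub>C x - c *\<^sub>C y"
  for x y :: "'a :: complex_vector"
  using scaleC_add_right[of c x "- y"] by (simp add: scaleC_minus_right)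

lemma scaleC_minus_left: "(- c) *\<^sub>C x = - (c *\<^sub>C x)" for x :: "'a :: complex_vector"
  by (metis mult_minus1 scaleC_minus1 scaleC_scaleC)

lemma adj_bounded_operators [simp]:
  assumes A: "A \<in> bounded_operators"
  shows "adj A \<in> bounded_operators"
  unfolding bounded_operators_def
proof clarify
  fix c x
  have "inner y (adj A (c *\<^sub>C x)) = inner y (c *\<^sub>C adj A x)" for y
  proof -
    have "inner y (adj A (c *\<^sub>C x)) = inner (cnj c *\<^sub>C A y) x"
      by (simp add: inner_scaleC_left flip: inner_adj[OF A])
    also have "\<dots> = inner (A (cnj c *\<^sub>C y)) x" using A by (simp add: bounded_operators_scaleC)
    also have "\<dots> = inner y (c *\<^sub>C adj A x)" by (simp add: inner_adj[OF A] inner_scaleC_left)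
    finally show ?thesis .
  qed
  then show "adj A (c *\<^sub>C x) = c *\<^sub>C adj A x" using vector_eq_ldot by blast
qed

lemma inner_adj_left:
  "A \<in> bounded_operators \<Longrightarrow> inner (adj A x) y = inner x (blinfun_apply A y)"
  by (metis inner_adj inner_commute)

lemma bounded_operators_closed [simp]:
  "id_blinfun \<in> bounded_operators"
  "A \<in> bounded_operators \<Longrightarrow> B \<in> bounded_operators \<Longrightarrow> A + B \<in> bounded_operators"
  "A \<in> bounded_operators \<Longrightarrow> B \<in> bounded_operators \<Longrightarrow> A o\<^sub>L B \<in> bounded_operators"
  "A \<in> bounded_operators \<Longrightarrow> c *\<^sub>C A \<in> bounded_operators"
  unfolding bounded_operators_def
  by (auto simp: blinfun.add_left scaleC_add_right scaleC_blinfun.rep_eq scaleC_scaleC mult.commute)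

lemma adj_adj [simp]: "A \<in> bounded_operators \<Longrightarrow> adj (adj A) = A"
  by (rule adj_unique) (simp_all add: inner_adj_left)

lemma adj_id [simp]: "adj id_blinfun = id_blinfun"
  by (rule adj_unique) simp_all

lemma adj_zero [simp]: "adj 0 = 0"
  by (rule adj_unique) (simp_all add: bounded_operators_def)

lemma adj_compose:
  "A \<in> bounded_operators \<Longrightarrow> B \<in> bounded_operators \<Longrightarrow> adj (A o\<^sub>L B) = adj B o\<^sub>L adj A"
  by (rule adj_unique) (simp_all add: inner_adj)

lemma adj_add:
  "A \<in> bounded_operators \<Longrightarrow> B \<in> bounded_operators \<Longrightarrow> adj (A + B) = adj A + adj B"
  by (rule adj_unique) (simp_all add: inner_adj blinfun.add_left inner_add)

lemma adj_scaleC: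
  "A \<in> bounded_operators \<Longrightarrow> adj (c *\<^sub>C A) = cnj c *\<^sub>C adj A"
  by (rule adj_unique)
    (simp_all add: inner_adj scaleC_blinfun.rep_eq inner_scaleC_left bounded_operators_scaleC)

lemma norm_adj_le:
  assumes A: "A \<in> bounded_operators"
  shows "norm (adj A) \<le> norm A"
proof (rule norm_blinfun_bound)
  fix y
  have "(norm (adj A y))\<^sup>2 = inner (A (adj A y)) y"
    by (simp add: inner_adj[OF A] power2_norm_eq_inner)
  also have "\<dots> \<le> norm (A (adj A y)) * norm y" by (rule norm_cauchy_schwarz)
  also have "\<dots> \<le> norm A * norm (adj A y) * norm y"
    by (intro mult_right_mono norm_blinfun) simp
  finally have "norm (adj A y) * norm (adj A y) \<le> norm (adj A y) * (norm A * norm y)"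
    by (simp add: power2_eq_square mult_ac)
  then show "norm (adj A y) \<le> norm A * norm y"
    by (cases "norm (adj A y) = 0") (auto simp: mult_le_cancel_left intro: mult_nonneg_nonneg)
qed simp

lemma norm_scaleC_blinfun:
  "norm (c *\<^sub>C A) \<le> cmod c * norm A" for A :: "'a :: complex_inner \<Rightarrow>\<^sub>L 'a"
  by (rule norm_blinfun_bound)
    (auto simp: scaleC_blinfun.rep_eq norm_scaleC norm_blinfun mult_left_mono mult.assoc)

lemmas blinfun_compose_simps =
  bounded_bilinear.add_left[OF bounded_bilinear_blinfun_compose]
  bounded_bilinear.add_right[OF bounded_bilinear_blinfun_compose]
  bounded_bilinear.diff_left[OF bounded_bilinear_blinfun_compose]
  bounded_bilinear.diff_right[OF bounded_bilinear_blinfun_compose]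
  bounded_bilinear.minus_left[OF bounded_bilinear_blinfun_compose]
  bounded_bilinear.minus_right[OF bounded_bilinear_blinfun_compose]
  bounded_bilinear.scaleR_left[OF bounded_bilinear_blinfun_compose]
  bounded_bilinear.scaleR_right[OF bounded_bilinear_blinfun_compose]

lemma blinfun_compose_id [simp]: "A o\<^sub>L id_blinfun = A" "id_blinfun o\<^sub>L A = A"
  by (auto intro: blinfun_eqI)

lemma blinfun_compose_assoc: "(A o\<^sub>L B) o\<^sub>L C = A o\<^sub>L (B o\<^sub>L C)"
  by (auto intro: blinfun_eqI)

lemma scaleC_compose_left: "(c *\<^sub>C A) o\<^sub>L B = c *\<^sub>C (A o\<^sub>L B)"
  for B :: "'a :: complex_inner \<Rightarrow>\<^sub>L 'a"
  by (auto intro: blinfun_eqI simp: scaleC_blinfun.rep_eq)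

text \<open>Elements of the operator type are only real-linear, so a complex scalar passes through
  the left factor only when that factor is in \<open>bounded_operators\<close>.\<close>

lemma scaleC_compose_right:
  "A \<in> bounded_operators \<Longrightarrow> A o\<^sub>L (c *\<^sub>C B) = c *\<^sub>C (A o\<^sub>L B)"
  by (auto intro: blinfun_eqI simp: scaleC_blinfun.rep_eq bounded_operators_scaleC)

section \<open>Star subalgebras\<close>

locale star_subalgebra =
  fixes M :: "('h :: chilbert_space \<Rightarrow>\<^sub>L 'h) set"
  assumes unital_star_subalgebra: "unital_star_subalgebra M"
begin

lemma BO [simp]: "A \<in> M \<Longrightarrow> A \<in> bounded_operators"
  and id_mem [simp]: "id_blinfun \<in> M"
  and add_mem [simp]: "A \<in> M \<Longrightarrow> B \<in> M \<Longrightarrow> A + B \<in> M"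
  and scaleC_mem [simp]: "A \<in> M \<Longrightarrow> c *\<^sub>C A \<in> M"
  and compose_mem [simp]: "A \<in> M \<Longrightarrow> B \<in> M \<Longrightarrow> A o\<^sub>L B \<in> M"
  and adj_mem [simp]: "A \<in> M \<Longrightarrow> adj A \<in> M"
  using unital_star_subalgebra unfolding unital_star_subalgebra_def by auto

lemma uminus_mem [simp]: "A \<in> M \<Longrightarrow> - A \<in> M"
  using scaleC_mem[of A "-1"] by (simp add: scaleC_minus1)

lemma diff_mem [simp]: "A \<in> M \<Longrightarrow> B \<in> M \<Longrightarrow> A - B \<in> M"
  using add_mem[of A "- B"] by simp

lemma scaleR_mem [simp]: "A \<in> M \<Longrightarrow> r *\<^sub>R A \<in> M"
  by (simp add: scaleR_scaleC)

lemma adj_uminus: "A \<in> M \<Longrightarrow> adj (- A) = - adj A"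
  using adj_scaleC[of A "-1"] by (simp add: scaleC_minus1)

lemma adj_diff: "A \<in> M \<Longrightarrow> B \<in> M \<Longrightarrow> adj (A - B) = adj A - adj B"
  using adj_add[of A "- B"] by (simp add: adj_uminus)

lemma adj_scaleR: "A \<in> M \<Longrightarrow> adj (r *\<^sub>R A) = r *\<^sub>R adj A"
  by (simp add: scaleR_scaleC adj_scaleC)

lemmas adj_simps = adj_add adj_diff adj_uminus adj_scaleR adj_scaleC adj_compose

section \<open>Extreme points of the unit ball\<close>

lemma isometry_norm:
  assumes "V \<in> M" "adj V o\<^sub>L V = id_blinfun"
  shows "norm (V x) = norm x"
proof -
  have "inner (V x) (V x) = inner x (adj V (V x))" using assms by (simp add: inner_adj)
  also have "adj V (V x) = x" using assms(2) by (metis blinfun_apply_blinfun_compose blinfun_apply_id_blinfun)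
  finally show ?thesis by (simp add: norm_eq_sqrt_inner)
qed

lemma isometry_norm_le_1:
  assumes "V \<in> M" "adj V o\<^sub>L V = id_blinfun"
  shows "norm V \<le> 1"
  by (rule norm_blinfun_bound) (simp_all add: isometry_norm[OF assms])

text \<open>Strict convexity of the Hilbert norm: \<open>V x\<close> has norm \<open>norm x\<close>
  and is a proper convex combination of \<open>A x\<close> and \<open>B x\<close>, whose norms do
  not exceed \<open>norm x\<close>, so \<open>A x = B x\<close>.\<close>

lemma isometry_extreme_point:
  assumes V: "V \<in> M" "adj V o\<^sub>L V = id_blinfun"
  shows "V extreme_point_of unit_ball M"
  unfolding extreme_point_of_def
proof (intro conjI ballI notI)
  show "V \<in> unit_ball M" using V isometry_norm_le_1 by (simp add: unit_ball_def)
next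
  fix A B assume AB: "A \<in> unit_ball M" "B \<in> unit_ball M" "V \<in> open_segment A B"
  then obtain u where u: "A \<noteq> B" "0 < u" "u < 1" "V = (1 - u) *\<^sub>R A + u *\<^sub>R B"
    by (auto simp: in_segment)
  have "A x = B x" for x
  proof -
    have le: "norm (C x) \<le> norm x" if "C \<in> unit_ball M" for C
      using that norm_blinfun[of C x] mult_right_mono[of "norm C" 1 "norm x"]
      by (auto simp: unit_ball_def)
    have "(norm x)\<^sup>2 = (norm ((1 - u) *\<^sub>R A x + u *\<^sub>R B x))\<^sup>2"
      using isometry_norm[OF V, of x] u(4) by (simp add: blinfun.add_left blinfun.scaleR_left)
    also have "\<dots> = (1 - u) * (norm (A x))\<^sup>2 + u * (norm (B x))\<^sup>2
        - u * (1 - u) * (norm (A x - B x))\<^sup>2"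
      unfolding power2_norm_eq_inner
      by (simp add: inner_diff inner_add algebra_simps inner_commute)
    also have "\<dots> \<le> (1 - u) * (norm x)\<^sup>2 + u * (norm x)\<^sup>2
        - u * (1 - u) * (norm (A x - B x))\<^sup>2"
      using u le[OF AB(1)] le[OF AB(2)]
      by (intro diff_right_mono add_mono mult_left_mono power_mono) auto
    finally have "u * (1 - u) * (norm (A x - B x))\<^sup>2 \<le> 0" by (simp add: algebra_simps)
    then show ?thesis using u by (simp add: mult_le_0_iff not_le zero_less_mult_iff)
  qed
  then show False using u(1) blinfun_eqI by blast
qed

text \<open>\<open>V\<close> is the midpoint of \<open>V + B\<close> and \<open>V - B\<close>. In
  this form extremality is tested against explicit perturbations.\<close>

lemma extreme_point_perturbation:
  assumes "V extreme_point_of unit_ball M" "B \<in> M" "norm (V + B) \<le> 1" "norm (V - B) \<le> 1"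
  shows "B = 0"
proof (rule ccontr)
  assume "B \<noteq> 0"
  have "V \<in> M" using assms(1) by (simp add: extreme_point_of_def unit_ball_def)
  then have "V + B \<in> unit_ball M" "V - B \<in> unit_ball M"
    using assms by (auto simp: unit_ball_def)
  moreover have "V \<in> open_segment (V + B) (V - B)"
    unfolding in_segment
  proof (intro conjI exI[of _ "1/2"])
    show "V + B \<noteq> V - B"
    proof
      assume "V + B = V - B"
      moreover have "2 *\<^sub>R B = (V + B) - (V - B)" by (simp add: scaleR_2)
      ultimately have "2 *\<^sub>R B = 0" by simp
      with \<open>B \<noteq> 0\<close> show False by simp
    qed
    have "(1 - 1/2) *\<^sub>R (V + B) + (1/2) *\<^sub>R (V - B) = (1/2) *\<^sub>R (V + B + (V - B))"
      by (simp only: scaleR_add_right) simp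
    also have "V + B + (V - B) = 2 *\<^sub>R V" by (simp add: scaleR_2)
    finally show "V = (1 - 1/2) *\<^sub>R (V + B) + (1/2) *\<^sub>R (V - B)" by simp
  qed auto
  ultimately show False using assms(1) unfolding extreme_point_of_def by blast
qed

text \<open>With \<open>T = V\<^sup>* V\<close>, the operator \<open>V\<close> is the mean of \<open>V (3 - T) / 2\<close> and \<open>V (1 + T) / 2\<close>; the first
  is a contraction because \<open>4 - T (3 - T)\<^sup>2 = (1 - T) (4 - T) (1 - T) \<ge> 0\<close>.\<close>

lemma extreme_point_partial_isometry:
  assumes V: "V extreme_point_of unit_ball M"
  shows "V o\<^sub>L (adj V o\<^sub>L V) = V"
proof -
  have VM: "V \<in> M" and nV: "norm V \<le> 1"
    using V by (auto simp: extreme_point_of_def unit_ball_def)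
  have V_le: "norm (V x) \<le> norm x" for x
    using norm_blinfun[of V x] mult_right_mono[OF nV, of "norm x"] by simp
  define T where "T = adj V o\<^sub>L V"
  have TM: "T \<in> M" using VM by (simp add: T_def)
  have Tadj: "inner (T x) y = inner x (T y)" for x y
    using VM by (simp add: T_def inner_adj inner_adj_left)
  have TV: "inner (T x) x = (norm (V x))\<^sup>2" for x
    using VM by (simp add: T_def inner_adj_left power2_norm_eq_inner)
  \<comment> \<open>Chosen so that \<open>V + B\<close> and \<open>V - B\<close> are the two
    operators of the mean, and so that \<open>B = 0\<close> is exactly the claim.\<close>
  define B where "B = (1/2) *\<^sub>R (V - (V o\<^sub>L T))"
  have "norm (V + B) \<le> 1"
  proof (rule norm_blinfun_bound)
    fix x
    define w where "w = x - T x"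
    have "(V + B) x = (1/2) *\<^sub>R V (3 *\<^sub>R x - T x)"
      using scaleR_left.add[of 1 "1/2" "V x"]
      unfolding B_def by (simp add: blinfun.bilinear_simps scaleR_diff_right)
    then have "4 * (norm ((V + B) x))\<^sup>2 = (norm (V (3 *\<^sub>R x - T x)))\<^sup>2"
      by (simp add: power2_eq_square)
    also have "\<dots> = inner (T (3 *\<^sub>R x - T x)) (3 *\<^sub>R x - T x)" by (simp add: TV)
    also have "\<dots> = 4 * (norm x)\<^sup>2 - (4 * (norm w)\<^sup>2 - inner (T w) w)"
      unfolding w_def power2_norm_eq_inner
      by (simp add: blinfun.bilinear_simps inner_diff Tadj algebra_simps inner_commute)
    also have "inner (T w) w \<le> (norm w)\<^sup>2" using TV V_le by (simp add: power_mono)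
    finally have "(norm ((V + B) x))\<^sup>2 \<le> (norm x)\<^sup>2" using zero_le_power2[of "norm w"] by linarith
    then show "norm ((V + B) x) \<le> 1 * norm x" by (simp add: power_mono_iff)
  qed simp
  moreover have "norm (V - B) \<le> 1"
  proof (rule norm_blinfun_bound)
    fix x
    have "norm (T x) \<le> norm x"
    proof -
      have "norm (adj V (V x)) \<le> norm (adj V) * norm (V x)" by (rule norm_blinfun)
      also have "\<dots> \<le> 1 * norm x"
        using norm_adj_le[of V] VM nV V_le by (intro mult_mono) auto
      finally show ?thesis by (simp add: T_def)
    qed
    then have "norm (x + T x) \<le> 2 * norm x" using norm_triangle_ineq[of x "T x"] by linarith
    moreover have "(V - B) x = (1/2) *\<^sub>R V (x + T x)"
      using scaleR_left.diff[of 1 "1/2" "V x"]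
      unfolding B_def by (simp add: blinfun.bilinear_simps scaleR_diff_right scaleR_add_right)
    ultimately show "norm ((V - B) x) \<le> 1 * norm x" using V_le[of "x + T x"] by simp
  qed simp
  moreover have "B \<in> M" using VM TM by (simp add: B_def)
  ultimately have "B = 0" using extreme_point_perturbation[OF V] by blast
  then show ?thesis by (simp add: B_def T_def)
qed

text \<open>For a contraction \<open>C\<close>, the vectors \<open>V x\<close> and
  \<open>Q (C (P x))\<close> are orthogonal, and the second has norm at most
  \<open>norm (P x)\<close>. By Pythagoras \<open>V\<close> perturbed by the corner element in
  either direction is still a contraction, so extremality kills the corner.\<close>

lemma extreme_point_corner_zero:
  assumes V: "V extreme_point_of unit_ball M" and B: "B \<in> M"
  shows "(id_blinfun - (V o\<^sub>L adj V)) o\<^sub>L (B o\<^sub>L (id_blinfun - (adj V o\<^sub>L V))) = 0"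
proof -
  have VM: "V \<in> M" and nV: "norm V \<le> 1"
    using V by (auto simp: extreme_point_of_def unit_ball_def)
  define P where "P = id_blinfun - (adj V o\<^sub>L V)"
  define Q where "Q = id_blinfun - (V o\<^sub>L adj V)"
  have VVV: "V (adj V (V x)) = V x" for x
    using arg_cong[OF extreme_point_partial_isometry[OF V], of "\<lambda>A. A x"] by simp
  have PM: "P \<in> M" and QM: "Q \<in> M" using VM by (simp_all add: P_def Q_def)
  \<comment> \<open>As \<open>V\<close> is a partial isometry, \<open>P\<close> is the projection
    onto its kernel.\<close>
  have Psq: "(norm (P x))\<^sup>2 = (norm x)\<^sup>2 - (norm (V x))\<^sup>2" for x
    using VM unfolding P_def power2_norm_eq_inner
    by (simp add: blinfun.bilinear_simps inner_diff inner_adj inner_adj_left VVV)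
  have QV: "inner (Q x) (V z) = 0" for x z
    using VM by (simp add: Q_def blinfun.bilinear_simps inner_diff inner_adj inner_adj_left VVV)
  have Qsq: "(norm (Q x))\<^sup>2 \<le> (norm x)\<^sup>2" for x
  proof -
    have "inner (Q x) (V (adj V x)) = 0" by (rule QV)
    then have "(norm (Q x))\<^sup>2 = inner (Q x) x"
      unfolding power2_norm_eq_inner by (simp add: Q_def blinfun.bilinear_simps inner_diff_right)
    also have "\<dots> \<le> norm (Q x) * norm x" by (rule norm_cauchy_schwarz)
    finally have "norm (Q x) * norm (Q x) \<le> norm (Q x) * norm x" by (simp add: power2_eq_square)
    then have "norm (Q x) \<le> norm x"
      by (cases "norm (Q x) = 0") (auto simp: mult_le_cancel_left)
    then show ?thesis by (simp add: power_mono)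
  qed
  have small: "Q o\<^sub>L (C o\<^sub>L P) = 0" if C: "C \<in> M" "norm C \<le> 1" for C
  proof (rule extreme_point_perturbation[OF V])
    have *: "(norm (V x))\<^sup>2 + (norm (Q (C (P x))))\<^sup>2 \<le> (norm x)\<^sup>2" for x
    proof -
      have "norm (C (P x)) \<le> norm (P x)"
        using norm_blinfun[of C "P x"] mult_right_mono[OF C(2), of "norm (P x)"] by simp
      then have "(norm (C (P x)))\<^sup>2 \<le> (norm (P x))\<^sup>2" by (simp add: power_mono)
      then show ?thesis using Qsq[of "C (P x)"] Psq[of x] by linarith
    qed
    show "norm (V + (Q o\<^sub>L (C o\<^sub>L P))) \<le> 1"
    proof (rule norm_blinfun_bound)
      fix x
      have "(norm ((V + (Q o\<^sub>L (C o\<^sub>L P))) x))\<^sup>2 = (norm (V x))\<^sup>2 + (norm (Q (C (P x))))\<^sup>2"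
        using QV[of "C (P x)" x] unfolding power2_norm_eq_inner
        by (simp add: blinfun.bilinear_simps inner_add inner_commute)
      with *[of x] show "norm ((V + (Q o\<^sub>L (C o\<^sub>L P))) x) \<le> 1 * norm x"
        by (simp add: power2_le_imp_le)
    qed simp
    show "norm (V - (Q o\<^sub>L (C o\<^sub>L P))) \<le> 1"
    proof (rule norm_blinfun_bound)
      fix x
      have "(norm ((V - (Q o\<^sub>L (C o\<^sub>L P))) x))\<^sup>2 = (norm (V x))\<^sup>2 + (norm (Q (C (P x))))\<^sup>2"
        using QV[of "C (P x)" x] unfolding power2_norm_eq_inner
        by (simp add: blinfun.bilinear_simps inner_diff inner_commute)
      with *[of x] show "norm ((V - (Q o\<^sub>L (C o\<^sub>L P))) x) \<le> 1 * norm x"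
        by (simp add: power2_le_imp_le)
    qed simp
  qed (use C PM QM in simp)
  have "Q o\<^sub>L (B o\<^sub>L P) = 0"
  \<comment> \<open>The corner condition is linear in \<open>B\<close>, so it is enough to have it
    for contractions.\<close>
  proof (cases "norm B = 0")
    case False
    then have "Q o\<^sub>L ((1 / norm B) *\<^sub>R B o\<^sub>L P) = 0" using B by (intro small) simp_all
    then show ?thesis using False by (simp add: blinfun_compose_simps)
  qed simp
  then show ?thesis by (simp add: P_def Q_def)
qed

end

section \<open>Central projections and finiteness\<close>

lemma commutant_adj:
  assumes "\<And>A. A \<in> S \<Longrightarrow> A \<in> bounded_operators \<and> adj A \<in> S" "T \<in> commutant S"
  shows "adj T \<in> commutant S"
proof -
  have T: "T \<in> bounded_operators" using assms(2) by (simp add: commutant_def)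
  have "adj T o\<^sub>L A = A o\<^sub>L adj T" if A: "A \<in> S" for A
  proof -
    have "T o\<^sub>L adj A = adj A o\<^sub>L T" using assms A by (simp add: commutant_def)
    then have "adj (T o\<^sub>L adj A) = adj (adj A o\<^sub>L T)" by simp
    then show ?thesis using assms(1)[OF A] T by (simp add: adj_compose)
  qed
  with T show ?thesis by (simp add: commutant_def)
qed

text \<open>The point of \<open>S\<close> with residual orthogonal to \<open>S\<close> is unique;
  additivity and homogeneity follow because the expected values also have this property.\<close>

lemma blinfun_projection_exists:
  fixes S :: "'a :: {real_inner, complete_space} set"
  assumes S: "subspace S" "closed S"
  obtains E :: "'a \<Rightarrow>\<^sub>L 'a" where "\<And>x. E x \<in> S" "\<And>x s. s \<in> S \<Longrightarrow> inner (x - E x) s = 0"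
proof -
  have "\<exists>y. y \<in> S \<and> (\<forall>s\<in>S. inner (x - y) s = 0)" for x
    using subspace_projection_exists[OF S, of x] by metis
  then obtain g where gS: "\<And>x. g x \<in> S" and g: "\<And>x s. s \<in> S \<Longrightarrow> inner (x - g x) s = 0"
    by metis
  have uniq: "g x = y" if y: "y \<in> S" "\<And>s. s \<in> S \<Longrightarrow> inner (x - y) s = 0" for x y
  proof -
    have "g x - y \<in> S" using S(1) gS y(1) by (simp add: subspace_diff)
    from g[OF this, of x] y(2)[OF this] have "inner (g x - y) (g x - y) = 0"
      by (simp add: inner_diff_left)
    then show ?thesis by simp
  qed
  have "bounded_linear g"
  proof (rule bounded_linear_intro)
    fix x y r
    show "g (x + y) = g x + g y"
    proof (rule uniq)
      show "g x + g y \<in> S" using S(1) gS by (simp add: subspace_add)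
      show "inner (x + y - (g x + g y)) s = 0" if "s \<in> S" for s
        using g[OF that, of x] g[OF that, of y] by (simp add: inner_diff_left inner_add_left)
    qed
    show "g (r *\<^sub>R x) = r *\<^sub>R g x"
    proof (rule uniq)
      show "r *\<^sub>R g x \<in> S" using S(1) gS by (simp add: subspace_scale)
      show "inner (r *\<^sub>R x - r *\<^sub>R g x) s = 0" if "s \<in> S" for s
        using g[OF that, of x] by (simp add: inner_diff_left)
    qed
    have "norm (g x) * norm (g x) = inner x (g x)"
      using g[OF gS, of x x] by (simp add: inner_diff_left flip: power2_norm_eq_inner power2_eq_square)
    also have "\<dots> \<le> norm x * norm (g x)" by (rule norm_cauchy_schwarz)
    finally show "norm (g x) \<le> norm x * 1"
      by (cases "norm (g x) = 0") (auto simp: mult_le_cancel_right)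
  qed
  then show thesis using that[of "Blinfun g"] gS g by (simp add: bounded_linear_Blinfun_apply)
qed

locale vn_algebra =
  fixes M :: "('h :: chilbert_space \<Rightarrow>\<^sub>L 'h) set"
  assumes von_neumann_algebra: "von_neumann_algebra M"

sublocale vn_algebra \<subseteq> star_subalgebra
  using von_neumann_algebra by unfold_locales (simp add: von_neumann_algebra_def)

context vn_algebra begin

lemma bicommutant: "commutant (commutant M) = M"
  using von_neumann_algebra by (simp add: von_neumann_algebra_def)

text \<open>\<open>M\<close> is a commutant, and a commutant is cut out by equations continuous in
  the operator norm.\<close>

lemma closed_M: "closed M"
proof -
  have "closed (commutant S)" for S :: "('h \<Rightarrow>\<^sub>L 'h) set"
  proof -
    have eq: "commutant S = (\<Inter>c. \<Inter>x. {T. blinfun_apply T (c *\<^sub>C x) - c *\<^sub>C blinfun_apply T x = 0})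
        \<inter> (\<Inter>A\<in>S. {T. T o\<^sub>L A = A o\<^sub>L T})"
      by (auto simp: commutant_def bounded_operators_def)
    have cont: "continuous_on UNIV (\<lambda>T :: 'h \<Rightarrow>\<^sub>L 'h. c *\<^sub>C T x)" for c x
      by (intro linear_continuous_on bounded_linear_compose[OF bounded_linear_scaleC]
          blinfun.bounded_linear_left)
    show ?thesis unfolding eq
      by (intro closed_Int closed_INT ballI closed_Collect_eq continuous_on_diff cont
          continuous_intros)
  qed
  then show ?thesis using bicommutant by metis
qed

text \<open>\<open>E\<close> projects onto the common kernel of the operators \<open>P B\<close> with \<open>B \<in> M\<close>. This subspace is
  invariant under both \<open>M\<close> and its commutant, which makes \<open>E\<close> central.\<close>

lemma central_projection_annihilating:
  assumes P: "P \<in> M"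
  obtains E where "E \<in> M" "\<And>A. A \<in> M \<Longrightarrow> E o\<^sub>L A = A o\<^sub>L E" "adj E = E" "E o\<^sub>L E = E" "P o\<^sub>L E = 0"
    "\<And>Q. Q \<in> M \<Longrightarrow> (\<And>B. B \<in> M \<Longrightarrow> P o\<^sub>L (B o\<^sub>L Q) = 0) \<Longrightarrow> E o\<^sub>L Q = Q"
proof -
  define S where "S = {x. \<forall>B\<in>M. P (blinfun_apply B x) = 0}"
  have "subspace S" by (auto simp: S_def subspace_def blinfun.bilinear_simps)
  moreover have "closed S"
  proof -
    have "S = (\<Inter>B\<in>M. {x. P (blinfun_apply B x) = 0})" by (auto simp: S_def)
    then show ?thesis by (auto intro!: closed_INT closed_Collect_eq continuous_intros)
  qed
  ultimately obtain E :: "'h \<Rightarrow>\<^sub>L 'h"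
    where ES: "\<And>x. E x \<in> S" and E: "\<And>x s. s \<in> S \<Longrightarrow> inner (x - E x) s = 0"
    using blinfun_projection_exists[of S] by blast
  have uniq: "E x = y" if y: "y \<in> S" "\<And>s. s \<in> S \<Longrightarrow> inner (x - y) s = 0" for x y
  proof -
    have "E x - y \<in> S" using \<open>subspace S\<close> ES y(1) by (simp add: subspace_diff)
    from E[OF this, of x] y(2)[OF this] have "inner (E x - y) (E x - y) = 0"
      by (simp add: inner_diff_left)
    then show ?thesis by simp
  qed
  have SC: "c *\<^sub>C x \<in> S" if "x \<in> S" for c x
    using that P unfolding S_def by (simp add: bounded_operators_scaleC)
  have EBO: "E \<in> bounded_operators"
    unfolding bounded_operators_def
  proof clarify
    fix c x
    show "E (c *\<^sub>C x) = c *\<^sub>C E x"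
    proof (rule uniq)
      show "c *\<^sub>C E x \<in> S" using ES SC by blast
      fix s assume s: "s \<in> S"
      have "c *\<^sub>C x - c *\<^sub>C E x = c *\<^sub>C (x - E x)"
        by (simp add: scaleC_diff_right)
      then show "inner (c *\<^sub>C x - c *\<^sub>C E x) s = 0"
        using E[OF SC[OF s]] by (simp add: inner_scaleC_left)
    qed
  qed
  \<comment> \<open>An operator commutes with the projection if it leaves both \<open>S\<close> and
    its orthogonal complement invariant; the latter is expressed as invariance of \<open>S\<close>
    under the adjoint.\<close>
  have commute: "E o\<^sub>L T = T o\<^sub>L E"
    if T: "T \<in> bounded_operators" "\<And>s. s \<in> S \<Longrightarrow> T s \<in> S" "\<And>s. s \<in> S \<Longrightarrow> adj T s \<in> S" for T
  proof (rule blinfun_eqI)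
    fix x
    have "E (T x) = T (E x)"
    proof (rule uniq)
      show "T (E x) \<in> S" using T ES by blast
      fix s assume s: "s \<in> S"
      have "T x - T (E x) = T (x - E x)" by (simp add: blinfun.bilinear_simps)
      then show "inner (T x - T (E x)) s = 0" using E[OF T(3)[OF s]] by (simp add: inner_adj[OF T(1)])
    qed
    then show "(E o\<^sub>L T) x = (T o\<^sub>L E) x" by simp
  qed
  have S_M: "T s \<in> S" if "T \<in> M" "s \<in> S" for T s
  proof -
    have "P ((B o\<^sub>L T) s) = 0" if "B \<in> M" for B
      using that \<open>T \<in> M\<close> \<open>s \<in> S\<close> compose_mem unfolding S_def by blast
    then show ?thesis by (simp add: S_def)
  qed
  \<comment> \<open>An element of the commutant moves past \<open>P o\<^sub>L B\<close>, which kills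
    \<open>s\<close>.\<close>
  have S_M': "T s \<in> S" if T: "T \<in> commutant M" and s: "s \<in> S" for T s
    unfolding S_def
  proof clarify
    fix B assume B: "B \<in> M"
    have "P (B (T s)) = ((P o\<^sub>L B) o\<^sub>L T) s" by simp
    also have "(P o\<^sub>L B) o\<^sub>L T = T o\<^sub>L (P o\<^sub>L B)"
      using T P B compose_mem by (simp add: commutant_def)
    also have "(T o\<^sub>L (P o\<^sub>L B)) s = 0" using s B by (simp add: S_def blinfun.bilinear_simps)
    finally show "P (B (T s)) = 0" .
  qed
  have "E \<in> commutant (commutant M)"
  proof -
    have "E o\<^sub>L T = T o\<^sub>L E" if T: "T \<in> commutant M" for T
    proof (rule commute)
      show "T \<in> bounded_operators" using T by (simp add: commutant_def)
      show "T s \<in> S" if "s \<in> S" for s using S_M' T that by blast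
      have "adj T \<in> commutant M" by (rule commutant_adj[OF _ T]) simp
      then show "adj T s \<in> S" if "s \<in> S" for s using S_M' that by blast
    qed
    then show ?thesis using EBO by (simp add: commutant_def)
  qed
  then have EM: "E \<in> M" by (simp add: bicommutant)
  have fix_S: "E s = s" if "s \<in> S" for s using that by (intro uniq) simp_all
  show thesis
  proof (rule that[OF EM])
    show "E o\<^sub>L A = A o\<^sub>L E" if "A \<in> M" for A using that by (intro commute S_M) simp_all
    show "adj E = E"
    proof (rule adj_unique[OF EBO])
      fix x y
      have "inner (E x) y = inner (E x) (E y)"
        using E[OF ES[of x], of y] by (simp add: inner_diff_right inner_commute[of _ "E x"])
      also have "\<dots> = inner x (E y)" using E[OF ES[of y], of x] by (simp add: inner_diff_left)
      finally show "inner (E x) y = inner x (E y)" .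
    qed
    show "E o\<^sub>L E = E" by (rule blinfun_eqI) (simp add: fix_S ES)
    have "P (E x) = 0" for x
    proof -
      have "P (id_blinfun (E x)) = 0" using ES[of x] id_mem unfolding S_def by blast
      then show ?thesis by simp
    qed
    then show "P o\<^sub>L E = 0" by (intro blinfun_eqI) simp
    fix Q assume Q: "Q \<in> M" "\<And>B. B \<in> M \<Longrightarrow> P o\<^sub>L (B o\<^sub>L Q) = 0"
    \<comment> \<open>The hypothesis on \<open>Q\<close> says that its range lies in
      \<open>S\<close>, where \<open>E\<close> acts as the identity.\<close>
    have "Q x \<in> S" for x
      unfolding S_def using Q(2)[THEN arg_cong, of _ "\<lambda>A. A x"] by simp
    then show "E o\<^sub>L Q = Q" by (intro blinfun_eqI) (simp add: fix_S)
  qed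
qed

end

locale finite_vn_algebra =
  fixes M :: "('h :: chilbert_space \<Rightarrow>\<^sub>L 'h) set"
  assumes finite_von_neumann_algebra: "finite_von_neumann_algebra M"

sublocale finite_vn_algebra \<subseteq> vn_algebra
  using finite_von_neumann_algebra by unfold_locales (simp add: finite_von_neumann_algebra_def)

context finite_vn_algebra begin

lemma isometry_coisometry:
  "V \<in> M \<Longrightarrow> adj V o\<^sub>L V = id_blinfun \<Longrightarrow> V o\<^sub>L adj V = id_blinfun"
  using finite_von_neumann_algebra by (simp add: finite_von_neumann_algebra_def)

text \<open>\<open>E\<close> kills the defect \<open>P\<close> and dominates the defect
  \<open>Q\<close>. On the range of \<open>E\<close> the operator \<open>V\<close> is therefore
  isometric, and extending it by the identity gives an isometry \<open>W\<close> of
  \<open>M\<close>. Finiteness makes \<open>W\<close> unitary, which forces \<open>Q\<close> to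
  vanish.\<close>

lemma extreme_point_isometry:
  assumes V: "V extreme_point_of unit_ball M"
  shows "V \<in> M" "adj V o\<^sub>L V = id_blinfun"
proof -
  show VM: "V \<in> M" using V by (simp add: extreme_point_of_def unit_ball_def)
  define P where "P = id_blinfun - (adj V o\<^sub>L V)"
  define Q where "Q = id_blinfun - (V o\<^sub>L adj V)"
  have PM: "P \<in> M" and QM: "Q \<in> M" using VM by (simp_all add: P_def Q_def)
  have Padj: "adj P = P" and Qadj: "adj Q = Q"
    using VM by (simp_all add: P_def Q_def adj_simps)
  \<comment> \<open>The corner relation has \<open>Q\<close> on the left; taking adjoints
    interchanges the two defects, as the choice of \<open>E\<close> requires.\<close>
  have PBQ: "P o\<^sub>L (B o\<^sub>L Q) = 0" if B: "B \<in> M" for B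
  proof -
    have "Q o\<^sub>L (adj B o\<^sub>L P) = 0"
      using extreme_point_corner_zero[OF V adj_mem[OF B]] by (simp add: P_def Q_def)
    then have "adj (Q o\<^sub>L (adj B o\<^sub>L P)) = adj 0" by simp
    then show ?thesis
      using PM QM B Padj Qadj by (simp add: adj_compose blinfun_compose_assoc)
  qed
  obtain E where E: "E \<in> M" "\<And>A. A \<in> M \<Longrightarrow> E o\<^sub>L A = A o\<^sub>L E" "adj E = E" "E o\<^sub>L E = E"
    "P o\<^sub>L E = 0" and EQ: "E o\<^sub>L Q = Q"
    using central_projection_annihilating[OF PM] PBQ QM by metis
  text \<open>If \<open>V\<close> were not a coisometry, then \<open>W\<close> would be a proper isometry.\<close>
  define W where "W = (V o\<^sub>L E) + (id_blinfun - E)"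
  have WM: "W \<in> M" using VM E(1) by (simp add: W_def)
  have EV: "E o\<^sub>L V = V o\<^sub>L E" "E o\<^sub>L adj V = adj V o\<^sub>L E"
    using E(2) VM by simp_all
  have EV': "E o\<^sub>L (V o\<^sub>L B) = V o\<^sub>L (E o\<^sub>L B)" "E o\<^sub>L (adj V o\<^sub>L B) = adj V o\<^sub>L (E o\<^sub>L B)" for B
    by (simp_all add: EV flip: blinfun_compose_assoc)
  have VVE: "adj V o\<^sub>L (V o\<^sub>L E) = E"
    using E(5) by (simp add: P_def blinfun_compose_simps blinfun_compose_assoc)
  have adjW: "adj W = (adj V o\<^sub>L E) + (id_blinfun - E)"
    using VM E(1,3) EV by (simp add: W_def adj_simps)
  have "adj W o\<^sub>L W = id_blinfun"
    unfolding adjW unfolding W_def 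
    by (simp add: blinfun_compose_simps blinfun_compose_assoc EV EV' E(4) VVE)
  then have "W o\<^sub>L adj W = id_blinfun" using isometry_coisometry WM by blast
  then have "V o\<^sub>L (adj V o\<^sub>L E) = E"
    unfolding adjW unfolding W_def 
    by (simp add: blinfun_compose_simps blinfun_compose_assoc EV EV' E(4))
  then have "Q o\<^sub>L E = 0" by (simp add: Q_def blinfun_compose_simps blinfun_compose_assoc)
  then have "Q = 0" using EQ E(2)[OF QM] by simp
  then have "V o\<^sub>L adj V = id_blinfun" by (simp add: Q_def)
  \<comment> \<open>Finiteness a second time, now for the isometry \<open>adj V\<close>.\<close>
  then show "adj V o\<^sub>L V = id_blinfun"
    using isometry_coisometry[of "adj V"] VM by simp
qed

lemma extreme_point_iff_isometry:
  "V extreme_point_of unit_ball M \<longleftrightarrow> V \<in> M \<and> adj V o\<^sub>L V = id_blinfun"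
  using extreme_point_isometry isometry_extreme_point by blast

end

section \<open>Linear maps preserving isometries\<close>

context star_subalgebra begin

text \<open>Expanding gives the sum of the squares plus \<open>\<i>\<close> times the commutator of
  \<open>S\<close> and \<open>A\<close>.\<close>

lemma selfadjoint_pair_isometry:
  assumes "S \<in> M" "A \<in> M" "adj S = S" "adj A = A"
    and "S o\<^sub>L A = A o\<^sub>L S" "(S o\<^sub>L S) + (A o\<^sub>L A) = id_blinfun"
  shows "adj (S + \<i> *\<^sub>C A) o\<^sub>L (S + \<i> *\<^sub>C A) = id_blinfun"
proof -
  have "adj (S + \<i> *\<^sub>C A) = S - \<i> *\<^sub>C A"
    using assms by (simp add: adj_simps scaleC_minus_left)
  then show ?thesis
    using assms by (simp add: blinfun_compose_simps scaleC_compose_left scaleC_compose_right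
        scaleC_scaleC scaleC_minus1)
qed

end

text \<open>\<open>Y = 1 - sqrt (1 - A\<^sup>2)\<close>, obtained as a fixed point of the contraction
  \<open>Y \<mapsto> (A\<^sup>2 + Y\<^sup>2) / 2\<close>, so that \<open>(1 - Y) \<plusminus> \<i> A\<close> is unitary.\<close>

lemma (in vn_algebra) sqrt_one_minus_square:
  assumes A: "A \<in> M" "adj A = A" "norm A \<le> 1/2"
  obtains Y where "Y \<in> M" "adj Y = Y" "Y o\<^sub>L A = A o\<^sub>L Y" "norm Y \<le> (norm A)\<^sup>2"
    "2 *\<^sub>R Y = (A o\<^sub>L A) + (Y o\<^sub>L Y)"
proof -
  define r where "r = (norm A)\<^sup>2"
  have r: "0 \<le> r" "r \<le> 1/4"
    using power_mono[OF A(3), of 2] by (simp_all add: r_def power2_eq_square)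
  \<comment> \<open>Self-adjointness is stated through the inner product because each such condition
    is visibly closed in \<open>Y\<close>.\<close>
  define D where "D = {Y \<in> M. Y o\<^sub>L A = A o\<^sub>L Y}
    \<inter> (\<Inter>x. \<Inter>y. {Y. inner (blinfun_apply Y x) y = inner x (blinfun_apply Y y)})
    \<inter> {Y. norm Y \<le> r}"
  define f where "f Y = (1/2) *\<^sub>R ((A o\<^sub>L A) + (Y o\<^sub>L Y))" for Y
  have sa: "inner (A x) y = inner x (A y)" for x y
    using A by (metis BO inner_adj)
  have D_iff: "Y \<in> D \<longleftrightarrow> Y \<in> M \<and> Y o\<^sub>L A = A o\<^sub>L Y \<and> (\<forall>x y. inner (Y x) y = inner x (Y y)) \<and> norm Y \<le> r"
    for Y by (auto simp: D_def)
  have "closed D"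
  proof -
    have "{Y \<in> M. Y o\<^sub>L A = A o\<^sub>L Y} = M \<inter> {Y. Y o\<^sub>L A = A o\<^sub>L Y}" by auto
    then show ?thesis
      unfolding D_def
      by (auto intro!: closed_Int closed_M closed_INT closed_Collect_eq closed_Collect_le
          continuous_intros)
  qed
  then have "complete D" by (simp add: complete_eq_closed)
  moreover have "D \<noteq> {}"
  proof -
    have "0 \<in> M" using scaleR_mem[OF id_mem, of 0] by simp
    then have "0 \<in> D" using r by (simp add: D_iff)
    then show ?thesis by blast
  qed
  moreover have "f ` D \<subseteq> D"
  proof clarify
    fix Y assume "Y \<in> D"
    then have Y: "Y \<in> M" "Y o\<^sub>L A = A o\<^sub>L Y" "\<And>x y. inner (Y x) y = inner x (Y y)" "norm Y \<le> r"
      by (auto simp: D_iff)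
    have YA: "Y o\<^sub>L (A o\<^sub>L B) = A o\<^sub>L (Y o\<^sub>L B)" for B
      by (metis Y(2) blinfun_compose_assoc)
    have "f Y \<in> M" using A Y by (simp add: f_def)
    moreover have "f Y o\<^sub>L A = A o\<^sub>L f Y"
      by (simp add: f_def blinfun_compose_simps blinfun_compose_assoc Y(2) YA)
    moreover have "inner (f Y x) y = inner x (f Y y)" for x y
      by (simp add: f_def blinfun.bilinear_simps inner_add sa Y(3))
    moreover have "norm (f Y) \<le> r"
    proof -
      have "norm (A o\<^sub>L A) \<le> r"
        using norm_blinfun_compose[of A A] by (simp add: r_def power2_eq_square)
      \<comment> \<open>One factor is bounded by \<open>r\<close> and the other by 1, so the mean of
        the two squares stays in the ball of radius \<open>r\<close>.\<close>
      moreover have "norm (Y o\<^sub>L Y) \<le> r * 1"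
        using norm_blinfun_compose[of Y Y] mult_mono[OF Y(4), of "norm Y" 1] Y(4) r by simp
      ultimately show ?thesis
        using norm_triangle_ineq[of "A o\<^sub>L A" "Y o\<^sub>L Y"] by (simp add: f_def)
    qed
    ultimately show "f Y \<in> D" by (simp add: D_iff)
  qed
  moreover have "dist (f Y) (f Z) \<le> (1/2) * dist Y Z" if "Y \<in> D" "Z \<in> D" for Y Z
  proof -
    \<comment> \<open>Factoring the difference of squares as \<open>Y (Y - Z) + (Y - Z) Z\<close>
      bounds the contraction factor by 1/4, within the 1/2 claimed.\<close>
    have n: "norm Y \<le> 1/4" "norm Z \<le> 1/4" using that r by (auto simp: D_iff)
    have "f Y - f Z = (1/2) *\<^sub>R ((Y o\<^sub>L (Y - Z)) + ((Y - Z) o\<^sub>L Z))"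
      unfolding f_def by (simp add: blinfun_compose_simps scaleR_diff_right scaleR_add_right)
    moreover have "norm (Y o\<^sub>L (Y - Z)) \<le> (1/4) * norm (Y - Z)"
      using norm_blinfun_compose[of Y "Y - Z"] mult_right_mono[OF n(1), of "norm (Y - Z)"] by simp
    moreover have "norm ((Y - Z) o\<^sub>L Z) \<le> (1/4) * norm (Y - Z)"
      using norm_blinfun_compose[of "Y - Z" Z] mult_right_mono[OF n(2), of "norm (Y - Z)"]
      by (simp add: mult.commute)
    moreover have "norm (f Y - f Z) = (1/2) * norm ((Y o\<^sub>L (Y - Z)) + ((Y - Z) o\<^sub>L Z))"
      using calculation(1) by simp
    ultimately show ?thesis
      using norm_triangle_ineq[of "Y o\<^sub>L (Y - Z)" "(Y - Z) o\<^sub>L Z"] norm_ge_zero[of "Y - Z"]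
      unfolding dist_norm by linarith
  qed
  ultimately have "\<exists>!Y\<in>D. f Y = Y" by (intro Banach_fix[of D "1/2" f]) auto
  then obtain Y where Y: "Y \<in> D" "f Y = Y" by blast
  have "2 *\<^sub>R Y = 2 *\<^sub>R f Y" using Y(2) by simp
  also have "\<dots> = (A o\<^sub>L A) + (Y o\<^sub>L Y)" by (simp add: f_def)
  finally have "2 *\<^sub>R Y = (A o\<^sub>L A) + (Y o\<^sub>L Y)" .
  moreover have "adj Y = Y" using Y(1) by (intro adj_unique) (auto simp: D_iff)
  ultimately show thesis using that Y(1) by (auto simp: D_iff r_def)
qed

text \<open>Let \<open>t\<close> tend to 0. This is how coefficients of powers of \<open>t\<close>
  are compared: a norm independent of \<open>t\<close> and bounded by a multiple of
  \<open>t\<^sup>2\<close> vanishes.\<close>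

lemma le_zero_if_le_square_small:
  fixes a c d :: real
  assumes d: "0 < d" and le: "\<And>t. 0 < t \<Longrightarrow> t \<le> d \<Longrightarrow> a \<le> c * t\<^sup>2"
  shows "a \<le> 0"
proof -
  have "((\<lambda>t. c * t\<^sup>2) \<longlongrightarrow> c * 0\<^sup>2) (at_right 0)" by (intro tendsto_intros)
  moreover have "eventually (\<lambda>t. a \<le> c * t\<^sup>2) (at_right 0)"
    using eventually_at_right_less[of 0] eventually_at_right_real[OF d]
    by eventually_elim (use le in auto)
  ultimately show ?thesis
    using tendsto_lowerbound[of "\<lambda>t. c * t\<^sup>2" "c * 0\<^sup>2" "at_right 0" a] by simp
qed

text \<open>Models the normalized map \<open>adj (\<Phi> id_blinfun) o\<^sub>L \<Phi> A\<close>,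
  with preservation of extreme points rephrased as preservation of isometries.\<close>

locale isometry_preserver = vn_algebra M
  for M :: "('h :: chilbert_space \<Rightarrow>\<^sub>L 'h) set" +
  fixes \<Psi> :: "('h \<Rightarrow>\<^sub>L 'h) \<Rightarrow> ('h \<Rightarrow>\<^sub>L 'h)"
  assumes clinear_map_on: "clinear_map_on M \<Psi>"
    and preserves_isometry:
      "\<And>V. V \<in> M \<Longrightarrow> adj V o\<^sub>L V = id_blinfun \<Longrightarrow> adj (\<Psi> V) o\<^sub>L \<Psi> V = id_blinfun"
    and unital: "\<Psi> id_blinfun = id_blinfun"
begin

lemma map_mem [simp]: "A \<in> M \<Longrightarrow> \<Psi> A \<in> M"
  and map_add: "A \<in> M \<Longrightarrow> B \<in> M \<Longrightarrow> \<Psi> (A + B) = \<Psi> A + \<Psi> B"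
  and map_scaleC: "A \<in> M \<Longrightarrow> \<Psi> (c *\<^sub>C A) = c *\<^sub>C \<Psi> A"
  using clinear_map_on unfolding clinear_map_on_def by auto

lemma map_uminus: "A \<in> M \<Longrightarrow> \<Psi> (- A) = - \<Psi> A"
  using map_scaleC[of A "-1"] by (simp add: scaleC_minus1)

lemma map_diff: "A \<in> M \<Longrightarrow> B \<in> M \<Longrightarrow> \<Psi> (A - B) = \<Psi> A - \<Psi> B"
  using map_add[of A "- B"] by (simp add: map_uminus)

lemma map_scaleR: "A \<in> M \<Longrightarrow> \<Psi> (r *\<^sub>R A) = r *\<^sub>R \<Psi> A"
  by (simp add: scaleR_scaleC map_scaleC)

lemmas map_simps = map_add map_diff map_uminus map_scaleR map_scaleC unital

text \<open>The equation for \<open>Y\<close> says that \<open>id_blinfun - Y\<close> squares to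
  \<open>1 - A\<^sup>2\<close>. Hence \<open>A\<close> and \<open>- A\<close> both complete it to an
  isometry, and \<open>\<Psi>\<close> carries the two isometries over.\<close>

lemma map_isometries:
  assumes A: "A \<in> M" "adj A = A" and Y: "Y \<in> M" "adj Y = Y" "Y o\<^sub>L A = A o\<^sub>L Y"
    and eq: "2 *\<^sub>R Y = (A o\<^sub>L A) + (Y o\<^sub>L Y)"
  defines "P \<equiv> id_blinfun - \<Psi> Y"
  shows "adj (P + \<i> *\<^sub>C \<Psi> A) o\<^sub>L (P + \<i> *\<^sub>C \<Psi> A) = id_blinfun"
    and "adj (P - \<i> *\<^sub>C \<Psi> A) o\<^sub>L (P - \<i> *\<^sub>C \<Psi> A) = id_blinfun"
proof -
  have *: "adj ((id_blinfun - Y) + \<i> *\<^sub>C B) o\<^sub>L ((id_blinfun - Y) + \<i> *\<^sub>C B) = id_blinfun"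
    if "B = A \<or> B = - A" for B
  proof (rule selfadjoint_pair_isometry)
    have "(id_blinfun - Y) o\<^sub>L (id_blinfun - Y) = id_blinfun - 2 *\<^sub>R Y + (Y o\<^sub>L Y)"
      by (simp add: blinfun_compose_simps scaleR_2)
    moreover have "B o\<^sub>L B = A o\<^sub>L A" using that by (auto simp: blinfun_compose_simps)
    ultimately show "((id_blinfun - Y) o\<^sub>L (id_blinfun - Y)) + (B o\<^sub>L B) = id_blinfun"
      using eq by simp
  qed (use that A Y in \<open>auto simp: adj_simps blinfun_compose_simps\<close>)
  show "adj (P + \<i> *\<^sub>C \<Psi> A) o\<^sub>L (P + \<i> *\<^sub>C \<Psi> A) = id_blinfun"
    using preserves_isometry[OF _ *[of A]] A Y by (simp add: map_simps P_def)
  show "adj (P - \<i> *\<^sub>C \<Psi> A) o\<^sub>L (P - \<i> *\<^sub>C \<Psi> A) = id_blinfun"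
    using preserves_isometry[OF _ *[of "- A"]] A Y
    by (simp add: map_simps P_def scaleC_minus_right)
qed

text \<open>After scaling \<open>A\<close> to norm 1/2, its image is, up to the factor
  \<open>\<i>\<close>, half the difference of two isometries and so has norm at most 1. Scaling back
  gives the constant 2.\<close>

lemma map_norm_le:
  assumes A: "A \<in> M" "adj A = A"
  shows "norm (\<Psi> A) \<le> 2 * norm A"
proof (cases "A = 0")
  case True
  have "0 \<in> M" using scaleR_mem[OF id_mem, of 0] by simp
  then have "\<Psi> 0 = 0" using map_scaleR[of 0 0] by simp
  then show ?thesis using True by simp
next
  case False
  define C where "C = (1 / (2 * norm A)) *\<^sub>R A"
  have C: "C \<in> M" "adj C = C" "norm C \<le> 1/2"
    using A False by (simp_all add: C_def adj_scaleR)
  obtain Y where Y: "Y \<in> M" "adj Y = Y" "Y o\<^sub>L C = C o\<^sub>L Y" "2 *\<^sub>R Y = (C o\<^sub>L C) + (Y o\<^sub>L Y)"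
    using sqrt_one_minus_square[OF C] by metis
  define P where "P = id_blinfun - \<Psi> Y"
  define D where "D = \<i> *\<^sub>C \<Psi> C"
  have PD: "P \<in> M" "D \<in> M" using Y C by (simp_all add: P_def D_def)
  note iso = map_isometries[OF C(1,2) Y, folded P_def D_def]
  have "norm (P + D) \<le> 1" "norm (P - D) \<le> 1"
    using isometry_norm_le_1 iso PD by simp_all
  moreover have "(P + D) - (P - D) = 2 *\<^sub>R D" by (simp add: scaleR_2)
  ultimately have "norm D \<le> 1" using norm_triangle_ineq4[of "P + D" "P - D"] by simp
  moreover have "\<Psi> C = (- \<i>) *\<^sub>C D" by (simp add: D_def scaleC_scaleC)
  ultimately have "norm (\<Psi> C) \<le> 1" using norm_scaleC_blinfun[of "- \<i>" D] by simp
  then show ?thesis using A False by (simp add: C_def map_scaleR field_simps)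
qed

text \<open>The two products expand to \<open>X + \<i> *\<^sub>C Z\<close> and
  \<open>X - \<i> *\<^sub>C Z\<close>; half their sum isolates \<open>X\<close>, and then
  \<open>Z\<close> must vanish.\<close>

lemma isometry_pair_expand:
  assumes "P \<in> M" "B \<in> M"
    and "adj (P + \<i> *\<^sub>C B) o\<^sub>L (P + \<i> *\<^sub>C B) = id_blinfun"
    and "adj (P - \<i> *\<^sub>C B) o\<^sub>L (P - \<i> *\<^sub>C B) = id_blinfun"
  shows "(adj P o\<^sub>L P) + (adj B o\<^sub>L B) = id_blinfun" "adj P o\<^sub>L B = adj B o\<^sub>L P"
proof -
  define X where "X = (adj P o\<^sub>L P) + (adj B o\<^sub>L B)"
  define Z where "Z = (adj P o\<^sub>L B) - (adj B o\<^sub>L P)"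
  have 1: "X + \<i> *\<^sub>C Z = id_blinfun"
    using assms by (simp add: X_def Z_def adj_simps scaleC_minus_left blinfun_compose_simps
        scaleC_compose_left scaleC_compose_right scaleC_scaleC scaleC_minus1 scaleC_diff_right
        algebra_simps)
  have 2: "X - \<i> *\<^sub>C Z = id_blinfun"
    using assms by (simp add: X_def Z_def adj_simps scaleC_minus_left blinfun_compose_simps
        scaleC_compose_left scaleC_compose_right scaleC_scaleC scaleC_minus1 scaleC_diff_right
        algebra_simps)
  have "2 *\<^sub>R X = (X + \<i> *\<^sub>C Z) + (X - \<i> *\<^sub>C Z)" by (simp add: scaleR_2)
  then have "2 *\<^sub>R X = 2 *\<^sub>R id_blinfun" unfolding 1 2 by (simp add: scaleR_2)
  then have X: "X = id_blinfun" by simp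
  then show "(adj P o\<^sub>L P) + (adj B o\<^sub>L B) = id_blinfun" by (simp add: X_def)
  have "\<i> *\<^sub>C Z = 0" using 1 X by simp
  then have "(- \<i>) *\<^sub>C (\<i> *\<^sub>C Z) = 0" by (simp only: scaleC_zero_right)
  then have "Z = 0" by (simp add: scaleC_scaleC)
  then show "adj P o\<^sub>L B = adj B o\<^sub>L P" by (simp add: Z_def)
qed

text \<open>The isometry relations for \<open>t *\<^sub>R A\<close>, with \<open>Y\<close> and its
  image both of order \<open>t\<^sup>2\<close>. The bound on \<open>t\<close> gives
  \<open>t *\<^sub>R A\<close> norm at most 1/2; the added 1 keeps the denominator positive when
  \<open>A = 0\<close>.\<close>

lemma small_scale_square_root:
  assumes A: "A \<in> M" "adj A = A" and t: "0 < t" "t \<le> 1 / (2 * (norm A + 1))"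
  obtains Y where "Y \<in> M" "adj Y = Y" "norm Y \<le> t\<^sup>2 * (norm A)\<^sup>2"
    "norm (\<Psi> Y) \<le> 2 * (t\<^sup>2 * (norm A)\<^sup>2)"
    "2 *\<^sub>R Y = t\<^sup>2 *\<^sub>R (A o\<^sub>L A) + (Y o\<^sub>L Y)"
    "(adj (id_blinfun - \<Psi> Y) o\<^sub>L (id_blinfun - \<Psi> Y)) + t\<^sup>2 *\<^sub>R (adj (\<Psi> A) o\<^sub>L \<Psi> A) = id_blinfun"
    "adj (id_blinfun - \<Psi> Y) o\<^sub>L \<Psi> A = adj (\<Psi> A) o\<^sub>L (id_blinfun - \<Psi> Y)"
proof -
  have "0 < norm A + 1" by (simp add: add_nonneg_pos)
  have "t * norm A \<le> t * (norm A + 1)" using t by simp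
  also have "\<dots> \<le> 1/2" using t(2) \<open>0 < norm A + 1\<close> by (simp add: pos_le_divide_eq mult_ac)
  finally have tA: "t *\<^sub>R A \<in> M" "adj (t *\<^sub>R A) = t *\<^sub>R A" "norm (t *\<^sub>R A) \<le> 1/2"
    using A t by (simp_all add: adj_scaleR)
  obtain Y where Y: "Y \<in> M" "adj Y = Y" "Y o\<^sub>L (t *\<^sub>R A) = (t *\<^sub>R A) o\<^sub>L Y"
      "2 *\<^sub>R Y = ((t *\<^sub>R A) o\<^sub>L (t *\<^sub>R A)) + (Y o\<^sub>L Y)" and nY: "norm Y \<le> (norm (t *\<^sub>R A))\<^sup>2"
    using sqrt_one_minus_square[OF tA] by metis
  have PB: "id_blinfun - \<Psi> Y \<in> M" "\<Psi> (t *\<^sub>R A) \<in> M" using Y tA(1) by simp_all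
  note e = isometry_pair_expand[OF PB map_isometries[OF tA(1,2) Y]]
  have nY': "norm Y \<le> t\<^sup>2 * (norm A)\<^sup>2" using nY by (simp add: power_mult_distrib)
  show thesis
  proof (rule that[OF Y(1,2) nY'])
    show "norm (\<Psi> Y) \<le> 2 * (t\<^sup>2 * (norm A)\<^sup>2)" using map_norm_le[OF Y(1,2)] nY' by linarith
    show "2 *\<^sub>R Y = t\<^sup>2 *\<^sub>R (A o\<^sub>L A) + (Y o\<^sub>L Y)"
      using Y(4) by (simp add: blinfun_compose_simps power2_eq_square)
    show "(adj (id_blinfun - \<Psi> Y) o\<^sub>L (id_blinfun - \<Psi> Y)) + t\<^sup>2 *\<^sub>R (adj (\<Psi> A) o\<^sub>L \<Psi> A) = id_blinfun"
      using e(1) A by (simp add: map_scaleR adj_scaleR blinfun_compose_simps power2_eq_square)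
    \<comment> \<open>The second relation is homogeneous in \<open>t\<close>, so one factor
      \<open>t\<close> cancels.\<close>
    have "t *\<^sub>R (adj (id_blinfun - \<Psi> Y) o\<^sub>L \<Psi> A) = t *\<^sub>R (adj (\<Psi> A) o\<^sub>L (id_blinfun - \<Psi> Y))"
      using e(2) A by (simp add: map_scaleR adj_scaleR
          bounded_bilinear.scaleR_left[OF bounded_bilinear_blinfun_compose]
          bounded_bilinear.scaleR_right[OF bounded_bilinear_blinfun_compose])
    then show "adj (id_blinfun - \<Psi> Y) o\<^sub>L \<Psi> A = adj (\<Psi> A) o\<^sub>L (id_blinfun - \<Psi> Y)"
      using t by simp
  qed
qed

text \<open>In the commutation relation of the small-scale lemma everything except
  \<open>\<Psi> A - adj (\<Psi> A)\<close> contains a factor \<open>\<Psi> Y\<close> or its adjoint,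
  hence is of order \<open>t\<^sup>2\<close>.\<close>

lemma map_selfadjoint:
  assumes A: "A \<in> M" "adj A = A"
  shows "adj (\<Psi> A) = \<Psi> A"
proof -
  have "norm (\<Psi> A - adj (\<Psi> A)) \<le> 0"
  proof (rule le_zero_if_le_square_small)
    show "0 < 1 / (2 * (norm A + 1))" by (simp add: add_nonneg_pos)
    fix t :: real assume t: "0 < t" "t \<le> 1 / (2 * (norm A + 1))"
    obtain Y where Y: "Y \<in> M" "norm (\<Psi> Y) \<le> 2 * (t\<^sup>2 * (norm A)\<^sup>2)"
      "adj (id_blinfun - \<Psi> Y) o\<^sub>L \<Psi> A = adj (\<Psi> A) o\<^sub>L (id_blinfun - \<Psi> Y)"
      using small_scale_square_root[OF A t] by metis
    define Z where "Z = \<Psi> Y"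
    have Z: "Z \<in> M" using Y by (simp add: Z_def)
    have "\<Psi> A - (adj Z o\<^sub>L \<Psi> A) = adj (\<Psi> A) - (adj (\<Psi> A) o\<^sub>L Z)"
      using Y(3) Z unfolding Z_def[symmetric] by (simp add: adj_simps blinfun_compose_simps)
    then have "\<Psi> A - adj (\<Psi> A) = (adj Z o\<^sub>L \<Psi> A) - (adj (\<Psi> A) o\<^sub>L Z)"
      by (simp add: algebra_simps)
    moreover have "norm (adj Z o\<^sub>L \<Psi> A) \<le> norm Z * norm (\<Psi> A)"
      using norm_blinfun_compose[of "adj Z" "\<Psi> A"] norm_adj_le[of Z] Z
      by (meson BO mult_right_mono norm_ge_zero order_trans)
    moreover have "norm (adj (\<Psi> A) o\<^sub>L Z) \<le> norm (\<Psi> A) * norm Z"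
      using norm_blinfun_compose[of "adj (\<Psi> A)" Z] norm_adj_le[of "\<Psi> A"] A
      by (meson BO map_mem mult_right_mono norm_ge_zero order_trans)
    ultimately have "norm (\<Psi> A - adj (\<Psi> A)) \<le> 2 * norm (\<Psi> A) * norm Z"
      using norm_triangle_ineq4[of "adj Z o\<^sub>L \<Psi> A" "adj (\<Psi> A) o\<^sub>L Z"]
      by (simp add: mult.commute[of "norm Z"])
    also have "\<dots> \<le> 2 * norm (\<Psi> A) * (2 * (t\<^sup>2 * (norm A)\<^sup>2))"
      using Y(2) by (intro mult_left_mono) (auto simp: Z_def)
    finally show "norm (\<Psi> A - adj (\<Psi> A)) \<le> (4 * norm (\<Psi> A) * (norm A)\<^sup>2) * t\<^sup>2"
      by (simp add: mult_ac)
  qed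
  then show ?thesis by simp
qed

text \<open>Both \<open>t\<^sup>2 *\<^sub>R (\<Psi> A o\<^sub>L \<Psi> A)\<close> and
  \<open>t\<^sup>2 *\<^sub>R \<Psi> (A o\<^sub>L A)\<close> equal
  \<open>2 *\<^sub>R \<Psi> Y\<close> up to terms quadratic in \<open>Y\<close>. Their difference is
  of order \<open>t^4\<close>, and dividing by \<open>t\<^sup>2\<close> leaves a bound that tends to
  0.\<close>

lemma map_selfadjoint_square:
  assumes A: "A \<in> M" "adj A = A"
  shows "\<Psi> A o\<^sub>L \<Psi> A = \<Psi> (A o\<^sub>L A)"
proof -
  have "norm ((\<Psi> A o\<^sub>L \<Psi> A) - \<Psi> (A o\<^sub>L A)) \<le> 0"
  proof (rule le_zero_if_le_square_small)
    show "0 < 1 / (2 * (norm A + 1))" by (simp add: add_nonneg_pos)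
    fix t :: real assume t: "0 < t" "t \<le> 1 / (2 * (norm A + 1))"
    obtain Y where Y: "Y \<in> M" "adj Y = Y" and nY: "norm Y \<le> t\<^sup>2 * (norm A)\<^sup>2"
        "norm (\<Psi> Y) \<le> 2 * (t\<^sup>2 * (norm A)\<^sup>2)"
      and eY: "2 *\<^sub>R Y = t\<^sup>2 *\<^sub>R (A o\<^sub>L A) + (Y o\<^sub>L Y)"
      and iso: "(adj (id_blinfun - \<Psi> Y) o\<^sub>L (id_blinfun - \<Psi> Y)) + t\<^sup>2 *\<^sub>R (adj (\<Psi> A) o\<^sub>L \<Psi> A)
        = id_blinfun"
      using small_scale_square_root[OF A t] by metis
    \<comment> \<open>\<open>s\<close> bounds \<open>norm Y\<close> and \<open>2 * s\<close> bounds
      \<open>norm (\<Psi> Y)\<close>; the final constant 6 is 2 + 4, from \<open>2 * (s * s)\<close>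
      and \<open>(2 * s) * (2 * s)\<close>.\<close>
    define s where "s = t\<^sup>2 * (norm A)\<^sup>2"
    have "t\<^sup>2 *\<^sub>R (\<Psi> A o\<^sub>L \<Psi> A) = 2 *\<^sub>R \<Psi> Y - (\<Psi> Y o\<^sub>L \<Psi> Y)"
      using iso A Y by (simp add: adj_simps map_selfadjoint blinfun_compose_simps scaleR_2 algebra_simps)
    moreover have "2 *\<^sub>R \<Psi> Y = t\<^sup>2 *\<^sub>R \<Psi> (A o\<^sub>L A) + \<Psi> (Y o\<^sub>L Y)"
      using arg_cong[OF eY, of \<Psi>] A Y by (simp add: map_simps)
    ultimately have "t\<^sup>2 *\<^sub>R ((\<Psi> A o\<^sub>L \<Psi> A) - \<Psi> (A o\<^sub>L A)) = \<Psi> (Y o\<^sub>L Y) - (\<Psi> Y o\<^sub>L \<Psi> Y)"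
      by (simp add: scaleR_diff_right)
    then have "t\<^sup>2 * norm ((\<Psi> A o\<^sub>L \<Psi> A) - \<Psi> (A o\<^sub>L A)) = norm (\<Psi> (Y o\<^sub>L Y) - (\<Psi> Y o\<^sub>L \<Psi> Y))"
      by (metis abs_power2 norm_scaleR)
    also have "\<dots> \<le> norm (\<Psi> (Y o\<^sub>L Y)) + norm (\<Psi> Y o\<^sub>L \<Psi> Y)" by (rule norm_triangle_ineq4)
    also have "norm (\<Psi> (Y o\<^sub>L Y)) \<le> 2 * norm (Y o\<^sub>L Y)"
      using Y by (intro map_norm_le) (simp_all add: adj_compose)
    also have "norm (Y o\<^sub>L Y) \<le> norm Y * norm Y" by (rule norm_blinfun_compose)
    also have "\<dots> \<le> s * s" using nY by (intro mult_mono) (auto simp: s_def)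
    also have "norm (\<Psi> Y o\<^sub>L \<Psi> Y) \<le> norm (\<Psi> Y) * norm (\<Psi> Y)" by (rule norm_blinfun_compose)
    also have "\<dots> \<le> (2 * s) * (2 * s)" using nY by (intro mult_mono) (auto simp: s_def)
    finally have "t\<^sup>2 * norm ((\<Psi> A o\<^sub>L \<Psi> A) - \<Psi> (A o\<^sub>L A)) \<le> t\<^sup>2 * (6 * (norm A)^4 * t\<^sup>2)"
      by (simp add: s_def power2_eq_square power4_eq_xxxx algebra_simps)
    then show "norm ((\<Psi> A o\<^sub>L \<Psi> A) - \<Psi> (A o\<^sub>L A)) \<le> (6 * (norm A)^4) * t\<^sup>2"
      using t by (simp add: mult_le_cancel_left)
  qed
  then show ?thesis by simp
qed

section \<open>From self-adjoint elements to the whole algebra\<close>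

lemma cartesian_decomposition:
  assumes "A \<in> M"
  obtains B C where "B \<in> M" "C \<in> M" "adj B = B" "adj C = C" "A = B + \<i> *\<^sub>C C"
proof
  let ?B = "(1/2) *\<^sub>R (A + adj A)" and ?C = "(1/2) *\<^sub>R ((- \<i>) *\<^sub>C (A - adj A))"
  show "?B \<in> M" "?C \<in> M" using assms by simp_all
  show "adj ?B = ?B" using assms by (simp add: adj_simps add.commute)
  show "adj ?C = ?C" using assms by (simp add: adj_simps scaleC_minus_left scaleC_diff_right)
  have "\<i> *\<^sub>C ?C = (1/2) *\<^sub>R (A - adj A)" by (simp add: scaleR_scaleC scaleC_scaleC)
  moreover have "?B + (1/2) *\<^sub>R (A - adj A) = (1/2) *\<^sub>R (2 *\<^sub>R A)"
    by (simp only: scaleR_2 flip: scaleR_add_right) simp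
  ultimately show "A = ?B + \<i> *\<^sub>C ?C" by simp
qed

lemma map_unital_jordan_star_hom: "unital_jordan_star_hom M \<Psi>"
  unfolding unital_jordan_star_hom_def jordan_star_hom_def
proof (intro conjI ballI)
  fix A assume "A \<in> M"
  then obtain B C where BC: "B \<in> M" "C \<in> M" "adj B = B" "adj C = C" and A: "A = B + \<i> *\<^sub>C C"
    by (rule cartesian_decomposition)
  show "adj (\<Psi> A) = \<Psi> (adj A)"
    unfolding A using BC by (simp add: adj_simps map_simps map_selfadjoint)
  \<comment> \<open>Polarization: squaring the self-adjoint \<open>B + C\<close> yields the
    anticommutator that appears in the square of \<open>B + \<i> *\<^sub>C C\<close>.\<close>
  have "\<Psi> (B + C) o\<^sub>L \<Psi> (B + C) = \<Psi> ((B + C) o\<^sub>L (B + C))"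
    using BC by (intro map_selfadjoint_square) (simp_all add: adj_add)
  then have cross: "(\<Psi> B o\<^sub>L \<Psi> C) + (\<Psi> C o\<^sub>L \<Psi> B) = \<Psi> (B o\<^sub>L C) + \<Psi> (C o\<^sub>L B)"
    using BC map_selfadjoint_square[of B] map_selfadjoint_square[of C]
    by (simp add: blinfun_compose_simps map_add algebra_simps)
  have expand: "(X + \<i> *\<^sub>C Y) o\<^sub>L (X + \<i> *\<^sub>C Y)
      = (X o\<^sub>L X) - (Y o\<^sub>L Y) + \<i> *\<^sub>C ((X o\<^sub>L Y) + (Y o\<^sub>L X))" if "X \<in> M" "Y \<in> M" for X Y
    using that by (simp add: blinfun_compose_simps scaleC_compose_left scaleC_compose_right
        scaleC_scaleC scaleC_minus1 scaleC_add_right)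
  show "\<Psi> A o\<^sub>L \<Psi> A = \<Psi> (A o\<^sub>L A)"
    unfolding A using BC
    by (simp add: map_simps expand cross map_selfadjoint_square)
qed (use clinear_map_on unital in auto)

end

section \<open>Jordan homomorphisms preserve unitaries\<close>

context star_subalgebra begin

text \<open>Jordan homomorphisms respect \<open>V V\<^sup>* + V\<^sup>* V = 2\<close> and \<open>V\<^sup>2 V\<^sup>* + V\<^sup>* V\<^sup>2 = 2 V\<close>. For the image \<open>X\<close>
  this gives \<open>X X\<^sup>* X = X\<close>, so \<open>X\<^sup>* X\<close> and \<open>X X\<^sup>*\<close> are projections with sum \<open>2\<close>.\<close>

lemma jordan_star_hom_isometry:
  assumes J: "unital_jordan_star_hom M \<Psi>"
    and V: "V \<in> M" "adj V o\<^sub>L V = id_blinfun" "V o\<^sub>L adj V = id_blinfun"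
  shows "adj (\<Psi> V) o\<^sub>L \<Psi> V = id_blinfun"
proof -
  have map: "\<And>A. A \<in> M \<Longrightarrow> \<Psi> A \<in> M" "\<And>A B. A \<in> M \<Longrightarrow> B \<in> M \<Longrightarrow> \<Psi> (A + B) = \<Psi> A + \<Psi> B"
    and sq: "\<And>A. A \<in> M \<Longrightarrow> \<Psi> A o\<^sub>L \<Psi> A = \<Psi> (A o\<^sub>L A)"
    and adj: "\<And>A. A \<in> M \<Longrightarrow> adj (\<Psi> A) = \<Psi> (adj A)" and unit: "\<Psi> id_blinfun = id_blinfun"
    using J unfolding unital_jordan_star_hom_def jordan_star_hom_def clinear_map_on_def by auto
  have anti: "(\<Psi> A o\<^sub>L \<Psi> B) + (\<Psi> B o\<^sub>L \<Psi> A) = \<Psi> (A o\<^sub>L B) + \<Psi> (B o\<^sub>L A)"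
    if AB: "A \<in> M" "B \<in> M" for A B
    using sq[of "A + B"] sq[of A] sq[of B] AB
    by (simp add: blinfun_compose_simps map algebra_simps)
  define X where "X = \<Psi> V"
  define p where "p = adj X o\<^sub>L X"
  define q where "q = X o\<^sub>L adj X"
  have aX: "adj X = \<Psi> (adj V)" using V by (simp add: X_def adj)
  have qp: "q = 2 *\<^sub>R id_blinfun - p"
    using anti[of V "adj V"] V unfolding p_def q_def aX
    by (simp add: X_def unit scaleR_2 algebra_simps)
  have "(V o\<^sub>L V) o\<^sub>L adj V = V" "adj V o\<^sub>L (V o\<^sub>L V) = V"
    using V by (metis blinfun_compose_assoc blinfun_compose_id)+
  then have "((X o\<^sub>L X) o\<^sub>L adj X) + (adj X o\<^sub>L (X o\<^sub>L X)) = 2 *\<^sub>R X"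
    using anti[of "V o\<^sub>L V" "adj V"] sq[of V] V unfolding aX by (simp add: X_def scaleR_2)
  then have sum: "(X o\<^sub>L q) + (p o\<^sub>L X) = 2 *\<^sub>R X"
    by (simp add: p_def q_def blinfun_compose_assoc)
  have Xp: "q o\<^sub>L X = X o\<^sub>L p" by (simp add: p_def q_def blinfun_compose_assoc)
  have Xq: "X o\<^sub>L q = 2 *\<^sub>R X - (X o\<^sub>L p)" by (simp add: qp blinfun_compose_simps)
  have "p = 2 *\<^sub>R id_blinfun - q" by (simp add: qp)
  then have "p o\<^sub>L X = 2 *\<^sub>R X - (q o\<^sub>L X)" by (metis (no_types) blinfun_compose_simps(3,7) blinfun_compose_id(2))
  \<comment> \<open>Both summands of \<open>sum\<close> have become
    \<open>2 *\<^sub>R X - (X o\<^sub>L p)\<close>.\<close>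
  then have "2 *\<^sub>R X - (X o\<^sub>L p) + (2 *\<^sub>R X - (X o\<^sub>L p)) = 2 *\<^sub>R X"
    using sum unfolding Xp Xq by metis
  then have "2 *\<^sub>R (X o\<^sub>L p) = 2 *\<^sub>R X" by (simp add: scaleR_2 algebra_simps)
  then have XXX: "X o\<^sub>L p = X" by simp
  have pp: "p o\<^sub>L p = p" using XXX by (simp add: p_def blinfun_compose_assoc)
  have "q o\<^sub>L q = q"
    using XXX Xp unfolding q_def by (metis blinfun_compose_assoc)
  \<comment> \<open>With \<open>q = 2 - p\<close> and \<open>p\<close> idempotent,
    \<open>q o\<^sub>L q = q\<close> reads \<open>4 - 3 p = 2 - p\<close>.\<close>
  then have "2 *\<^sub>R p = 2 *\<^sub>R id_blinfun"
    unfolding qp using pp by (simp add: blinfun_compose_simps scaleR_2 algebra_simps)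
  then show ?thesis by (simp add: p_def X_def)
qed

end

section \<open>Equivalence of extreme point preservation and the factorization\<close>

theorem theorem2:
  fixes M :: "('h :: chilbert_space \<Rightarrow>\<^sub>L 'h) set"
    and \<Phi> :: "('h \<Rightarrow>\<^sub>L 'h) \<Rightarrow> ('h \<Rightarrow>\<^sub>L 'h)"
  assumes "finite_von_neumann_algebra M"
    and "clinear_map_on M \<Phi>"
  shows "preserves_extreme_points M \<Phi> \<longleftrightarrow>
    (\<exists>U \<Psi>. U \<in> M \<and> unitary_op U \<and> unital_jordan_star_hom M \<Psi> \<and>
       (\<forall>A\<in>M. \<Phi> A = U o\<^sub>L \<Psi> A))"
proof -
  interpret finite_vn_algebra M by unfold_locales fact
  show ?thesis
  proof
    assume "preserves_extreme_points M \<Phi>"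
    then have pres: "\<Phi> V \<in> M \<and> adj (\<Phi> V) o\<^sub>L \<Phi> V = id_blinfun"
      if "V \<in> M" "adj V o\<^sub>L V = id_blinfun" for V
      using that by (simp add: preserves_extreme_points_def extreme_point_iff_isometry)
    \<comment> \<open>The identity is an isometry, so its image is one; finiteness then makes it
      unitary, and dividing by it normalizes the map.\<close>
    define U where "U = \<Phi> id_blinfun"
    have UM: "U \<in> M" and UU: "adj U o\<^sub>L U = id_blinfun" using pres[of id_blinfun] by (simp_all add: U_def)
    then have UU': "U o\<^sub>L adj U = id_blinfun" by (simp add: isometry_coisometry)
    define \<Psi> where "\<Psi> A = adj U o\<^sub>L \<Phi> A" for A
    have lin: "\<And>A. A \<in> M \<Longrightarrow> \<Phi> A \<in> M" "\<And>A B. A \<in> M \<Longrightarrow> B \<in> M \<Longrightarrow> \<Phi> (A + B) = \<Phi> A + \<Phi> B"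
      "\<And>c A. A \<in> M \<Longrightarrow> \<Phi> (c *\<^sub>C A) = c *\<^sub>C \<Phi> A"
      using assms(2) by (auto simp: clinear_map_on_def)
    have U_cancel: "U o\<^sub>L (adj U o\<^sub>L B) = B" for B
      by (metis UU' blinfun_compose_assoc blinfun_compose_id(2))
    interpret isometry_preserver M \<Psi>
    proof
      show "clinear_map_on M \<Psi>"
        using UM by (auto simp: clinear_map_on_def \<Psi>_def lin blinfun_compose_simps scaleC_compose_right)
      show "\<Psi> id_blinfun = id_blinfun" using UU by (simp add: \<Psi>_def U_def)
      fix V assume V: "V \<in> M" "adj V o\<^sub>L V = id_blinfun"
      then show "adj (\<Psi> V) o\<^sub>L \<Psi> V = id_blinfun"
        using UM pres[OF V] by (simp add: \<Psi>_def adj_compose blinfun_compose_assoc U_cancel)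
    qed
    have "\<Phi> A = U o\<^sub>L \<Psi> A" for A by (simp add: \<Psi>_def U_cancel)
    moreover have "unitary_op U" using UM UU UU' by (simp add: unitary_op_def)
    ultimately show "\<exists>U \<Psi>. U \<in> M \<and> unitary_op U \<and> unital_jordan_star_hom M \<Psi> \<and>
       (\<forall>A\<in>M. \<Phi> A = U o\<^sub>L \<Psi> A)"
      using UM map_unital_jordan_star_hom by blast
  next
    assume "\<exists>U \<Psi>. U \<in> M \<and> unitary_op U \<and> unital_jordan_star_hom M \<Psi> \<and>
       (\<forall>A\<in>M. \<Phi> A = U o\<^sub>L \<Psi> A)"
    then obtain U \<Psi> where U: "U \<in> M" "adj U o\<^sub>L U = id_blinfun"
      and J: "unital_jordan_star_hom M \<Psi>" and eq: "\<And>A. A \<in> M \<Longrightarrow> \<Phi> A = U o\<^sub>L \<Psi> A"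
      by (auto simp: unitary_op_def)
    have \<Psi>M: "\<Psi> A \<in> M" if "A \<in> M" for A
      using J that by (auto simp: unital_jordan_star_hom_def jordan_star_hom_def clinear_map_on_def)
    have U_cancel: "adj U o\<^sub>L (U o\<^sub>L B) = B" for B
      by (metis U(2) blinfun_compose_assoc blinfun_compose_id(2))
    show "preserves_extreme_points M \<Phi>"
      unfolding preserves_extreme_points_def extreme_point_iff_isometry
    proof (intro allI impI)
      fix V assume V: "V \<in> M \<and> adj V o\<^sub>L V = id_blinfun"
      \<comment> \<open>Finiteness turns the isometry \<open>V\<close> into a unitary, as
        \<open>jordan_star_hom_isometry\<close> requires.\<close>
      then have "adj (\<Psi> V) o\<^sub>L \<Psi> V = id_blinfun"
        using jordan_star_hom_isometry[OF J] isometry_coisometry by blast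
      then show "\<Phi> V \<in> M \<and> adj (\<Phi> V) o\<^sub>L \<Phi> V = id_blinfun"
        using V U \<Psi>M by (simp add: eq adj_compose blinfun_compose_assoc U_cancel)
    qed
  qed
qed

end
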